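(* Suppose the system $x(k+1)=A_0x(k)+B_0u(k)+E_0f(k)$, $y(k)=C_0x(k)$ satisfies Assumption 1 (stated in the context) with positive integers $r_1,\dots,r_p$, and that the disturbance gain matrix $V_0$ is diagonal. Consider the model-based extended state observer (MB-ESO) $$\hat{\underline{x}}(k+1)=A\hat{\underline{x}}(k)+Bu(k)+L\bigl(y(k)-C\hat{\underline{x}}(k)\bigr),\qquad \hat{\underline{x}}=\begin{bmatrix}\hat x\\ \hat f\end{bmatrix},$$ where the gain $L$ is chosen so that all subsystems of the observer are decoupled and all $r_i+1$ eigenvalues of the $i$-th subsystem are placed at $\omega_{o_i}$, inside the unit circle, $i=1,\dots,p$. Then the MB-ESO has the following properties. (i) The estimation error of $f$ is $$f(k)-\hat f(k)=\operatorname{diag}(h_1(k),\dots,h_p(k))\ast\Delta f(k),$$ where $\ast$ represents convolution, $\Delta f(k)=f(k+1)-f(k)$ is the variation of the true disturbance, and $$h_i(k)=\begin{cases}1, & 1\le k\le r_i+1,\\[4pt] \displaystyle\sum_{\iota=1}^{r_i+1}\frac{1}{(\iota-1)!}\Bigl(\prod_{j=-\iota+1}^{-1}(k+j)\Bigr)(1-\omega_{o_i})^{\iota-1}\omega_{o_i}^{k-\iota}, & k\ge r_i+2.\end{cases}$$ (ii) After $r_i+1$ steps following a change in $f_i$, the estimation error of $f_i$ decreases monotonically to zero as $\omega_{o_i}$ decreases, where $0<\omega_{o_i}<1$. (iii) For any fixed $0<\omega_{o_i}<1$, the estimation error of $f_i$ decreases monotonically to zero as time $k$ increases, after $r_i+1$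 steps following a change in $f_i$.
   Context: System: $x(k)\in\mathbb{R}^n$, $u(k)\in\mathbb{R}^m$ (known input), $f(k)\in\mathbb{R}^p$ (unknown disturbance, with components $f_i$), $y(k)\in\mathbb{R}^p$; $A_0,B_0,E_0,C_0$ are known real matrices of appropriate sizes; $C_0$ has full row rank. $c_i^0$ is the $i$-th row of $C_0$ and $e_j^0$ the $j$-th column of $E_0$. The estimation error of $f_i$ is $f_i(k)-\hat f_i(k)$. Convention: the empty product $\prod_{j=0}^{-1}(k+j)$ equals $1$. The convolution in (i) is the discrete-time one, acting componentwise: the $i$-th component is $h_i\ast\Delta f_i$, with $h_i(k)=0$ for $k\le 0$. Assumption 1 (with positive integers $r_1,\dots,r_p$): $c_i^0A_0^{\kappa}e_j^0=0$ for all $1\le i,j\le p$ and all integers $0\le\kappa<r_i-1$; $r_1+\cdots+r_p=n$; and the $p\times p$ disturbance gain matrix $V_0$ with $(i,j)$ entry $c_i^0A_0^{r_i-1}e_j^0$ is nonsingular. Augmented matrices: $$A=\begin{bmatrix}A_0&E_0\\0_{p\times n}&I_p\end{bmatrix},\quad B=\begin{bmatrix}B_0\\0_{p\times m}\end{bmatrix},\quad C=[C_0,\ 0_{p\times p}];$$ the augmented state is $\underline{x}=[x^\top,f^\top]^\top$. Canonical coordinates (used to define the subsystems). The outputs are ordered so that there are real coefficients $a_{ij\kappa}$, with $a_{ij\kappa}=0$ for $\kappa\ge r_j$, such that for $i=1,\dots,p$ $$c_i^0A_0^{r_i}=\sum_{j=1}^p\sum_{\kappa=0}^{r_i-1}a_{ij\kappa}c_j^0A_0^{\kappa}+\sum_{j<i}a_{ijr_i}c_j^0A_0^{r_i}.$$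 Put $\bar{\bar c}_i^0=c_i^0-\sum_{j<i}a_{ijr_i}c_j^0$. Then $\bar{\bar c}_i^0A_0^{r_i}=\sum_{j=1}^p\sum_{\kappa=0}^{r_i-1}b_{ij\kappa}\bar{\bar c}_j^0A_0^{\kappa}$ with real coefficients $b_{ij\kappa}$, $b_{ij\kappa}=0$ for $\kappa\ge r_j$. Set $b_{ij\kappa}=0$ also for $\kappa<0$ and $\kappa\ge r_i$, and put $d_{ij\kappa}=b_{ij(\kappa-1)}-b_{ij\kappa}+\delta_{ij}\delta_{\kappa r_i}$ ($\delta$ is the Kronecker delta). Let $S$ be the $(n+p)\times(n+p)$ matrix whose rows are, in order for $i=1,\dots,p$ and, within each $i$, for $\kappa=0,\dots,r_i$, the rows $[\bar{\bar c}_i^0,\ 0_{1\times p}]A^{\kappa}$. Let $Q_1$ be the $(n+p)\times(n+p)$ block matrix with blocks $Q^1_{ij}$ of size $(r_i+1)\times(r_j+1)$ whose $(s,t)$ entry is $-d_{ij,\,r_i+1-s+t}$ if $s>t$, and $\delta_{ij}\delta_{st}$ if $s\le t$. Let $T=Q_1S$ (an invertible matrix). The observer has $p$ subsystems, the $i$-th one corresponding to the $i$-th block of $r_i+1$ coordinates of $T\underline{x}$. "All subsystems of the observer are decoupled" means that $T(A-LC)T^{-1}$ is block diagonal with respect to the partition into blocks of sizes $r_1+1,\dots,r_p+1$; the eigenvalues of the $i$-th subsystem are those of its $i$-th diagonal block.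
   Formalization: The observer is assumed to start with zero augmented estimation error (x̂(0)=x(0), f̂(0)=f(0)), without which formula (i) fails, e.g. for constant f with f̂(0)≠f(0); "a change in f_i" in (ii) and (iii) means one isolated change, and "error" means its absolute value. *)

theory Defs
  imports
    Complex_Main
    "Jordan_Normal_Form.Matrix"
    "Jordan_Normal_Form.Char_Poly"
    "Jordan_Normal_Form.Gauss_Jordan_Elimination"
    "Jordan_Normal_Form.DL_Rank"
begin

text \<open>
  All indices are 0-based: channels are \<open>i < p\<close>, and the entries of the \<open>i\<close>-th block of
  coordinates are \<open>\<kappa> \<le> r i\<close>.  Time runs over the natural numbers.
\<close>

subsection \<open>Plant\<close>

definition plant_trajectory ::
  "nat \<Rightarrow> nat \<Rightarrow> nat \<Rightarrow> real mat \<Rightarrow> real mat \<Rightarrow> real mat \<Rightarrow> real mat \<Rightarrow>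
   (nat \<Rightarrow> real vec) \<Rightarrow> (nat \<Rightarrow> real vec) \<Rightarrow> (nat \<Rightarrow> real vec) \<Rightarrow> (nat \<Rightarrow> real vec) \<Rightarrow> bool"
where
  "plant_trajectory n m p A0 B0 E0 C0 u f x y \<longleftrightarrow>
     (\<forall>k. u k \<in> carrier_vec m \<and> f k \<in> carrier_vec p \<and> x k \<in> carrier_vec n \<and>
          x (Suc k) = A0 *\<^sub>v x k + B0 *\<^sub>v u k + E0 *\<^sub>v f k \<and>
          y k = C0 *\<^sub>v x k)"

definition gain_mat :: "nat \<Rightarrow> (nat \<Rightarrow> nat) \<Rightarrow> real mat \<Rightarrow> real mat \<Rightarrow> real mat \<Rightarrow> real mat" where
  "gain_mat p r A0 E0 C0 =
     mat p p (\<lambda>(i, j). row C0 i \<bullet> ((A0 ^\<^sub>m (r i - 1)) *\<^sub>v col E0 j))"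

definition relative_degree_condition ::
  "nat \<Rightarrow> nat \<Rightarrow> (nat \<Rightarrow> nat) \<Rightarrow> real mat \<Rightarrow> real mat \<Rightarrow> real mat \<Rightarrow> bool"
where
  "relative_degree_condition n p r A0 E0 C0 \<longleftrightarrow>
     (\<forall>i<p. \<forall>j<p. \<forall>\<kappa> < r i - 1. row C0 i \<bullet> ((A0 ^\<^sub>m \<kappa>) *\<^sub>v col E0 j) = 0) \<and>
     (\<Sum>i<p. r i) = n \<and>
     invertible_mat (gain_mat p r A0 E0 C0)"

subsection \<open>Augmented system\<close>

text \<open>The block row \<open>[M, 0]\<close> with \<open>q\<close> zero columns appended.\<close>

definition pad_cols :: "nat \<Rightarrow> real mat \<Rightarrow> real mat" where
  "pad_cols q M = four_block_mat M (0\<^sub>m (dim_row M) q) (0\<^sub>m 0 (dim_col M)) (0\<^sub>m 0 q)"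

definition aug_A :: "nat \<Rightarrow> nat \<Rightarrow> real mat \<Rightarrow> real mat \<Rightarrow> real mat" where
  "aug_A n p A0 E0 = four_block_mat A0 E0 (0\<^sub>m p n) (1\<^sub>m p)"

definition aug_B :: "nat \<Rightarrow> nat \<Rightarrow> real mat \<Rightarrow> real mat" where
  "aug_B m p B0 = B0 @\<^sub>r 0\<^sub>m p m"

definition aug_C :: "nat \<Rightarrow> real mat \<Rightarrow> real mat" where
  "aug_C p C0 = pad_cols p C0"

subsection \<open>Canonical coordinates\<close>

definition C_bar ::
  "nat \<Rightarrow> nat \<Rightarrow> (nat \<Rightarrow> nat) \<Rightarrow> real mat \<Rightarrow> (nat \<Rightarrow> nat \<Rightarrow> nat \<Rightarrow> real) \<Rightarrow> real mat"
where
  "C_bar n p r C0 a = mat p n (\<lambda>(i, l). C0 $$ (i, l) - (\<Sum>j<i. a i j (r i) * C0 $$ (j, l)))"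

text \<open>
  The vector identities between rows are written out entry by entry (column \<open>l\<close>).
  Under the relative degree condition, the last three conjuncts determine the values
  \<open>b i j \<kappa>\<close> for \<open>i, j < p\<close> uniquely once \<open>a\<close> is given, and such values always exist.
\<close>

definition canonical_coeffs ::
  "nat \<Rightarrow> nat \<Rightarrow> (nat \<Rightarrow> nat) \<Rightarrow> real mat \<Rightarrow> real mat \<Rightarrow>
   (nat \<Rightarrow> nat \<Rightarrow> nat \<Rightarrow> real) \<Rightarrow> (nat \<Rightarrow> nat \<Rightarrow> nat \<Rightarrow> real) \<Rightarrow> bool"
where
  "canonical_coeffs n p r A0 C0 a b \<longleftrightarrow>
     (\<forall>i<p. \<forall>j<p. \<forall>\<kappa> \<ge> r j. a i j \<kappa> = 0) \<and>
     (\<forall>i<p. \<forall>l<n. (C0 * A0 ^\<^sub>m r i) $$ (i, l) =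
        (\<Sum>j<p. \<Sum>\<kappa><r i. a i j \<kappa> * (C0 * A0 ^\<^sub>m \<kappa>) $$ (j, l)) +
        (\<Sum>j<i. a i j (r i) * (C0 * A0 ^\<^sub>m r i) $$ (j, l))) \<and>
     (\<forall>i<p. \<forall>j<p. \<forall>\<kappa> \<ge> r j. b i j \<kappa> = 0) \<and>
     (\<forall>i<p. \<forall>j<p. \<forall>\<kappa> \<ge> r i. b i j \<kappa> = 0) \<and>
     (\<forall>i<p. \<forall>l<n. (C_bar n p r C0 a * A0 ^\<^sub>m r i) $$ (i, l) =
        (\<Sum>j<p. \<Sum>\<kappa><r i. b i j \<kappa> * (C_bar n p r C0 a * A0 ^\<^sub>m \<kappa>) $$ (j, l)))"

definition d_coeff ::
  "(nat \<Rightarrow> nat) \<Rightarrow> (nat \<Rightarrow> nat \<Rightarrow> nat \<Rightarrow> real) \<Rightarrow> nat \<Rightarrow> nat \<Rightarrow> nat \<Rightarrow> real"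
where
  "d_coeff r b i j \<kappa> =
     (if \<kappa> = 0 then 0 else b i j (\<kappa> - 1)) - b i j \<kappa> + (if i = j \<and> \<kappa> = r i then 1 else 0)"

text \<open>
  Entry \<open>a\<close> of this list is the pair (block, position in the block) of the flat index \<open>a\<close>.
\<close>

definition block_index :: "nat \<Rightarrow> (nat \<Rightarrow> nat) \<Rightarrow> (nat \<times> nat) list" where
  "block_index p r = concat (map (\<lambda>i. map (Pair i) [0..<r i + 1]) [0..<p])"

definition S_mat ::
  "nat \<Rightarrow> nat \<Rightarrow> (nat \<Rightarrow> nat) \<Rightarrow> real mat \<Rightarrow> real mat \<Rightarrow> real mat \<Rightarrow>
   (nat \<Rightarrow> nat \<Rightarrow> nat \<Rightarrow> real) \<Rightarrow> real mat"
where
  "S_mat n p r A0 E0 C0 a =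
     mat_of_rows (n + p)
       (map (\<lambda>(i, \<kappa>). row (pad_cols p (C_bar n p r C0 a) * aug_A n p A0 E0 ^\<^sub>m \<kappa>) i)
         (block_index p r))"

text \<open>The index \<open>r i + 1 - s + t\<close> is unaffected by the shift of \<open>s\<close> and \<open>t\<close> to 0-based positions.\<close>

definition Q1_mat ::
  "nat \<Rightarrow> nat \<Rightarrow> (nat \<Rightarrow> nat) \<Rightarrow> (nat \<Rightarrow> nat \<Rightarrow> nat \<Rightarrow> real) \<Rightarrow> real mat"
where
  "Q1_mat n p r b =
     mat (n + p) (n + p) (\<lambda>(v, w).
       case (block_index p r ! v, block_index p r ! w) of ((i, s), (j, t)) \<Rightarrow>
         if s > t then - d_coeff r b i j (r i + 1 - s + t)
         else if i = j \<and> s = t then 1 else 0)"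

definition T_mat ::
  "nat \<Rightarrow> nat \<Rightarrow> (nat \<Rightarrow> nat) \<Rightarrow> real mat \<Rightarrow> real mat \<Rightarrow> real mat \<Rightarrow>
   (nat \<Rightarrow> nat \<Rightarrow> nat \<Rightarrow> real) \<Rightarrow> (nat \<Rightarrow> nat \<Rightarrow> nat \<Rightarrow> real) \<Rightarrow> real mat"
where
  "T_mat n p r A0 E0 C0 a b = Q1_mat n p r b * S_mat n p r A0 E0 C0 a"

subsection \<open>Observer\<close>

text \<open>
  The transformed error matrix is block diagonal with blocks \<open>F i\<close>, and the
  \<open>r i + 1\<close> eigenvalues of \<open>F i\<close> (roots of the characteristic polynomial, with
  multiplicity) are all equal to \<open>\<omega> i\<close>.  Since \<open>F i\<close> is a real matrix, its trace shows that
  \<open>\<omega> i\<close> is necessarily real.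
\<close>

definition eso_gain ::
  "nat \<Rightarrow> nat \<Rightarrow> (nat \<Rightarrow> nat) \<Rightarrow> real mat \<Rightarrow> real mat \<Rightarrow> real mat \<Rightarrow>
   (nat \<Rightarrow> nat \<Rightarrow> nat \<Rightarrow> real) \<Rightarrow> (nat \<Rightarrow> nat \<Rightarrow> nat \<Rightarrow> real) \<Rightarrow>
   (nat \<Rightarrow> real) \<Rightarrow> real mat \<Rightarrow> bool"
where
  "eso_gain n p r A0 E0 C0 a b \<omega> L \<longleftrightarrow>
     L \<in> carrier_mat (n + p) p \<and>
     (\<exists>F. (\<forall>i<p. F i \<in> carrier_mat (r i + 1) (r i + 1) \<and>
                 char_poly (F i) = [:- \<omega> i, 1:] ^ (r i + 1)) \<and>
          T_mat n p r A0 E0 C0 a b * (aug_A n p A0 E0 - L * aug_C p C0) *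
            the (mat_inverse (T_mat n p r A0 E0 C0 a b)) =
          diag_block_mat (map F [0..<p]))"

definition eso_trajectory ::
  "nat \<Rightarrow> nat \<Rightarrow> nat \<Rightarrow> real mat \<Rightarrow> real mat \<Rightarrow> real mat \<Rightarrow> real mat \<Rightarrow> real mat \<Rightarrow>
   (nat \<Rightarrow> real vec) \<Rightarrow> (nat \<Rightarrow> real vec) \<Rightarrow> (nat \<Rightarrow> real vec) \<Rightarrow> bool"
where
  "eso_trajectory n m p A0 B0 E0 C0 L u y xh \<longleftrightarrow>
     (\<forall>k. xh k \<in> carrier_vec (n + p) \<and>
          xh (Suc k) = aug_A n p A0 E0 *\<^sub>v xh k + aug_B m p B0 *\<^sub>v u k +
                       L *\<^sub>v (y k - aug_C p C0 *\<^sub>v xh k))"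

definition dist_error :: "nat \<Rightarrow> (nat \<Rightarrow> real vec) \<Rightarrow> (nat \<Rightarrow> real vec) \<Rightarrow> nat \<Rightarrow> real vec" where
  "dist_error p f xh k = f k - vec_last (xh k) p"

subsection \<open>Impulse response and disturbance variation\<close>

definition impulse_resp :: "nat \<Rightarrow> real \<Rightarrow> nat \<Rightarrow> real" where
  "impulse_resp \<rho> \<omega> k =
     (if k = 0 then 0
      else if k \<le> \<rho> + 1 then 1
      else \<Sum>\<iota> = 1..\<rho> + 1. 1 / fact (\<iota> - 1) *
             (\<Prod>j \<in> {- int \<iota> + 1..- 1}. real_of_int (int k + j)) *
             (1 - \<omega>) ^ (\<iota> - 1) * \<omega> ^ (k - \<iota>))"

text \<open>Convolution of causal signals, i.e. signals that vanish at negative times.\<close>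

definition conv :: "(nat \<Rightarrow> real) \<Rightarrow> (nat \<Rightarrow> real) \<Rightarrow> nat \<Rightarrow> real" where
  "conv g s k = (\<Sum>l\<le>k. g (k - l) * s l)"

definition variation :: "(nat \<Rightarrow> real vec) \<Rightarrow> nat \<Rightarrow> real vec" where
  "variation f k = f (Suc k) - f k"

text \<open>A single change of \<open>f\<^sub>i\<close>, occurring between the times \<open>k0\<close> and \<open>k0 + 1\<close>.\<close>

definition single_change :: "(nat \<Rightarrow> real vec) \<Rightarrow> nat \<Rightarrow> nat \<Rightarrow> bool" where
  "single_change f i k0 \<longleftrightarrow>
     variation f k0 $ i \<noteq> 0 \<and> (\<forall>l. l \<noteq> k0 \<longrightarrow> variation f l $ i = 0)"

end

theory Submission
  imports Defs
begin

text \<open>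
  Let \<open>e\<close> be the augmented state minus its estimate and \<open>z = T *\<^sub>v e\<close>. A step of the disturbance
  variation enters block \<open>i\<close> of \<open>z\<close> only in its last coordinate, with factor \<open>gain i\<close>, and the sum
  of the coordinates of block \<open>i\<close> is \<open>gain i\<close> times the estimation error of \<open>f\<^sub>i\<close>. Decoupling makes
  the dynamics of block \<open>i\<close> a companion matrix, determined by its first column and hence by the
  characteristic polynomial \<open>(X - \<omega>\<^sub>i) ^ (r\<^sub>i + 1)\<close>. Solving the resulting recursion, the impulse
  response at time \<open>N + 1\<close> is the probability that a binomial variable with parameters \<open>N\<close> and
  \<open>1 - \<omega>\<^sub>i\<close> is at most \<open>r\<^sub>i\<close>; both monotonicity claims are properties of this probability.
\<close>

subsection \<open>The impulse response as a binomial distribution function\<close>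

text \<open>The constants in \<open>T\<close> come from the model that the disturbance stays
  constant. With X for one step of the augmented plant, \<open>X ^ (r i + 1)\<close> minus the
  polynomial with coefficients \<open>d i j\<close> is X - 1 times the plant relation
  (\<open>X ^ r i\<close> minus the polynomial with coefficients \<open>b i j\<close>, the leading
  powers occurring for i = j only). The factor X - 1 removes a constant f, so the relation, valid
  for the undisturbed plant alone, becomes one that holds on every augmented state. The same
  structure makes tail sums of \<open>d\<close> telescope to \<open>b\<close>, and this is why the
  plain sum of a block isolates the disturbance error.

  The obstacle is that \<open>L\<close> is known only through the decoupled form it produces.
  Neither \<open>L\<close> nor the first columns of the blocks are ever computed: states hidden from
  the measurement fix all other columns, and the first column matters only through the
  characteristic polynomial. Its value at 1, \<open>(1 - \<omega> i) ^ (r i + 1)\<close>, controls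
  how the block sum evolves. Diagonality of the gain matrix keeps each disturbance in its own
  block.\<close>

text \<open>This is the binomial probability without its factor \<open>(1 - \<omega>) ^ j\<close>.
  In this form it is the impulse response, after one initial delay, of \<open>j + 1\<close> cascaded
  first-order filters with pole \<open>\<omega>\<close>.\<close>

definition binom_weight :: "nat \<Rightarrow> real \<Rightarrow> nat \<Rightarrow> real" where
  "binom_weight j \<omega> N = real (N choose j) * \<omega> ^ (N - j)"

definition binom_cdf :: "nat \<Rightarrow> real \<Rightarrow> nat \<Rightarrow> real" where
  "binom_cdf \<rho> \<omega> N = (\<Sum>j\<le>\<rho>. (1 - \<omega>) ^ j * binom_weight j \<omega> N)"

lemma binom_weight_0: "binom_weight 0 \<omega> N = \<omega> ^ N"
  by (simp add: binom_weight_def)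

lemma binom_weight_eq_0: "N < j \<Longrightarrow> binom_weight j \<omega> N = 0"
  by (simp add: binom_weight_def)

lemma binom_weight_pos: "0 < \<omega> \<Longrightarrow> j \<le> N \<Longrightarrow> 0 < binom_weight j \<omega> N"
  by (simp add: binom_weight_def)

lemma binom_weight_nonneg: "0 \<le> \<omega> \<Longrightarrow> 0 \<le> binom_weight j \<omega> N"
  by (simp add: binom_weight_def)

lemma binom_weight_Suc_Suc: "binom_weight (Suc j) \<omega> (Suc N) = \<omega> * binom_weight (Suc j) \<omega> N + binom_weight j \<omega> N"
proof (cases "Suc j \<le> N")
  case True
  then have "\<omega> ^ (N - j) = \<omega> * \<omega> ^ (N - Suc j)"
    by (metis Suc_diff_le diff_Suc_Suc power_Suc)
  then show ?thesis
    by (simp add: binom_weight_def algebra_simps)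
qed (simp add: binom_weight_def binomial_eq_0)

text \<open>One more trial leaves the event "at most \<open>\<rho>\<close> successes" exactly when
  there were \<open>\<rho>\<close> successes before and the new trial succeeds. The identity is
  polynomial, hence valid for every real \<open>\<omega>\<close>, as claim (i) requires.\<close>

lemma binom_cdf_Suc:
  "binom_cdf \<rho> \<omega> (Suc N) = binom_cdf \<rho> \<omega> N - (1 - \<omega>) ^ Suc \<rho> * binom_weight \<rho> \<omega> N"
proof (induction \<rho>)
  case 0
  then show ?case by (simp add: binom_cdf_def binom_weight_0 algebra_simps)
next
  case (Suc \<rho>)
  then show ?case
    by (simp add: binom_cdf_def binom_weight_Suc_Suc algebra_simps)
qed

lemma binom_cdf_eq_1: "N \<le> \<rho> \<Longrightarrow> binom_cdf \<rho> \<omega> N = 1"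
proof (induction N)
  case 0
  have "(\<Sum>j\<le>\<rho>. (1 - \<omega>) ^ j * binom_weight j \<omega> 0) = (\<Sum>j\<le>\<rho>. if j = 0 then 1 else 0)"
    by (rule sum.cong) (auto simp: binom_weight_def)
  then show ?case by (simp add: binom_cdf_def)
qed (simp add: binom_cdf_Suc binom_weight_eq_0)

lemma impulse_resp_Suc: "impulse_resp \<rho> \<omega> (Suc N) = binom_cdf \<rho> \<omega> N"
proof (cases "N \<le> \<rho>")
  case True
  then show ?thesis by (simp add: impulse_resp_def binom_cdf_eq_1)
next
  case False
  \<comment> \<open>The product is the falling factorial N (N - 1) ... (N - q + 1), with q equal to
    the summation index of \<open>impulse_resp\<close> minus 1.\<close>
  have P: "(\<Prod>j \<in> {- int q..- 1}. real_of_int (int (Suc N) + j)) / fact q = real (N choose q)" for q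
  proof -
    have "(\<Prod>j \<in> {- int q..- 1}. real_of_int (int (Suc N) + j)) = (\<Prod>i = 0..<q. real N - real i)"
      by (rule prod.reindex_bij_witness[of _ "\<lambda>i. - 1 - int i" "\<lambda>j. nat (- 1 - j)"]) auto
    then show ?thesis
      by (simp add: binomial_gbinomial gbinomial_prod_rev)
  qed
  have "impulse_resp \<rho> \<omega> (Suc N) =
    (\<Sum>q = 0..\<rho>. 1 / fact q * (\<Prod>j \<in> {- int q..- 1}. real_of_int (int (Suc N) + j)) *
      (1 - \<omega>) ^ q * \<omega> ^ (N - q))"
    using False
    by (simp add: impulse_resp_def sum.shift_bounds_cl_Suc_ivl del: sum.cl_ivl_Suc of_int_add)
  also have "\<dots> = (\<Sum>q = 0..\<rho>. (1 - \<omega>) ^ q * binom_weight q \<omega> N)"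
    by (rule sum.cong) (simp_all add: binom_weight_def P[symmetric] mult.commute mult.left_commute)
  finally show ?thesis
    by (simp add: binom_cdf_def atMost_atLeast0)
qed

lemma impulse_resp_0: "impulse_resp \<rho> \<omega> 0 = 0"
  by (simp add: impulse_resp_def)

lemma binom_cdf_pos:
  assumes "0 < \<omega>" "\<omega> < 1"
  shows "0 < binom_cdf \<rho> \<omega> N"
proof -
  have "0 < (1 - \<omega>) ^ 0 * binom_weight 0 \<omega> N" using assms by (simp add: binom_weight_0)
  also have "\<dots> \<le> binom_cdf \<rho> \<omega> N" unfolding binom_cdf_def
    using assms by (intro member_le_sum) (auto intro!: mult_nonneg_nonneg binom_weight_nonneg)
  finally show ?thesis .
qed

lemma binom_cdf_tendsto_0:
  assumes "0 < \<omega>" "\<omega> < 1"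
  shows "binom_cdf \<rho> \<omega> \<longlonglongrightarrow> 0"
proof -
  \<comment> \<open>The increments of the convergent decreasing sequence \<open>binom_cdf j \<omega>\<close> are multiples of \<open>binom_weight j \<omega>\<close>.\<close>
  have k: "binom_weight j \<omega> \<longlonglongrightarrow> 0" for j
  proof -
    have "decseq (binom_cdf j \<omega>)"
      using assms binom_weight_nonneg[of \<omega> j] by (intro decseq_SucI) (simp add: binom_cdf_Suc)
    then obtain l where l: "binom_cdf j \<omega> \<longlonglongrightarrow> l"
      using decseq_convergent[of "binom_cdf j \<omega>" 0] binom_cdf_pos[OF assms] less_imp_le by metis
    have "(\<lambda>N. (binom_cdf j \<omega> N - binom_cdf j \<omega> (Suc N)) / (1 - \<omega>) ^ Suc j) \<longlonglongrightarrow> (l - l) / (1 - \<omega>) ^ Suc j"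
      using assms by (intro tendsto_intros l LIMSEQ_Suc) auto
    moreover have "(\<lambda>N. (binom_cdf j \<omega> N - binom_cdf j \<omega> (Suc N)) / (1 - \<omega>) ^ Suc j) = binom_weight j \<omega>"
      using assms by (auto simp: binom_cdf_Suc simp del: power_Suc)
    ultimately show ?thesis by simp
  qed
  have "(\<lambda>N. \<Sum>j\<le>\<rho>. (1 - \<omega>) ^ j * binom_weight j \<omega> N) \<longlonglongrightarrow> (\<Sum>j\<le>\<rho>. (1 - \<omega>) ^ j * 0)"
    by (intro tendsto_intros k)
  then show ?thesis by (simp add: binom_cdf_def[abs_def])
qed

section \<open>Dependence of the binomial distribution function on the pole\<close>

lemma binom_weight_has_deriv:
  "((\<lambda>w. binom_weight j w N) has_real_derivative real (Suc j) * binom_weight (Suc j) w N) (at w)"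
proof -
  have "(N - j) * (N choose j) = Suc j * (N choose Suc j)"
  proof (cases N)
    case (Suc M)
    then show ?thesis
      using binomial_absorb_comp[of N j] binomial_absorption[of j "N"] by simp
  qed simp
  then have "real (N choose j) * real (N - j) = real (Suc j) * real (N choose Suc j)"
    by (metis mult.commute of_nat_mult)
  moreover have "((\<lambda>w. binom_weight j w N) has_real_derivative
      real (N choose j) * (real (N - j) * w ^ (N - j - 1))) (at w)"
    unfolding binom_weight_def by (rule derivative_eq_intros refl | simp)+
  ultimately show ?thesis
    by (simp add: binom_weight_def mult.assoc[symmetric])
qed

text \<open>Differentiating a summand gives the difference of two consecutive terms of one sequence,
  so the sum telescopes and only the top term survives.\<close>

lemma binom_cdf_has_deriv:
  "((\<lambda>w. binom_cdf \<rho> w N) has_real_derivative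
     real (Suc \<rho>) * (1 - w) ^ \<rho> * binom_weight (Suc \<rho>) w N) (at w)"
proof (induction \<rho>)
  case 0
  show ?case using binom_weight_has_deriv[of 0 N w] by (simp add: binom_cdf_def)
next
  case (Suc \<rho>)
  have "((\<lambda>w. binom_cdf \<rho> w N + (1 - w) ^ Suc \<rho> * binom_weight (Suc \<rho>) w N) has_real_derivative
      real (Suc \<rho>) * (1 - w) ^ \<rho> * binom_weight (Suc \<rho>) w N +
      (- (real (Suc \<rho>) * (1 - w) ^ \<rho>) * binom_weight (Suc \<rho>) w N +
       real (Suc (Suc \<rho>)) * binom_weight (Suc (Suc \<rho>)) w N * (1 - w) ^ Suc \<rho>)) (at w)"
    by (rule DERIV_add[OF Suc DERIV_mult[OF _ binom_weight_has_deriv]])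
      (rule derivative_eq_intros refl | simp)+
  then show ?case
    by (simp add: binom_cdf_def mult_ac)
qed

text \<open>The condition \<open>\<rho> < N\<close> makes the weight of index
  \<open>\<rho> + 1\<close> in the derivative positive; for smaller \<open>N\<close> the function is
  constantly 1.\<close>

lemma binom_cdf_strict_mono:
  assumes "\<rho> < N"
  shows "strict_mono_on {0<..<1} (\<lambda>w. binom_cdf \<rho> w N)"
proof (rule strict_mono_onI)
  fix v w :: real
  assume "v \<in> {0<..<1}" "w \<in> {0<..<1}" "v < w"
  then have "0 < real (Suc \<rho>) * (1 - x) ^ \<rho> * binom_weight (Suc \<rho>) x N" if "v \<le> x" "x \<le> w" for x
    using assms that by (auto intro!: mult_pos_pos binom_weight_pos)
  then show "binom_cdf \<rho> v N < binom_cdf \<rho> w N"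
    using binom_cdf_has_deriv by (intro DERIV_pos_imp_increasing[OF \<open>v < w\<close>]) blast
qed

lemma binom_cdf_at_0:
  assumes "\<rho> < N"
  shows "((\<lambda>w. binom_cdf \<rho> w N) \<longlongrightarrow> 0) (at_right 0)"
proof -
  have "isCont (\<lambda>w. binom_cdf \<rho> w N) 0"
    by (rule DERIV_isCont[OF binom_cdf_has_deriv])
  moreover have "binom_cdf \<rho> 0 N = 0"
    using assms by (auto simp: binom_cdf_def binom_weight_def intro!: sum.neutral)
  ultimately have "((\<lambda>w. binom_cdf \<rho> w N) \<longlongrightarrow> 0) (at 0)"
    by (simp add: isCont_def)
  then show ?thesis
    by (rule filterlim_mono) (auto simp: at_le)
qed

text \<open>\<open>Y 0\<close> is a first-order filter driven by \<open>\<nu>\<close>, and each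
  \<open>Y (Suc j)\<close> is the same filter driven by \<open>Y j\<close>. Pascal's rule in the
  form \<open>binom_weight_Suc_Suc\<close> is the recursion of the cascade.\<close>

lemma binom_weight_response:
  fixes Y :: "nat \<Rightarrow> nat \<Rightarrow> real"
  assumes "\<And>k. Y 0 (Suc k) = \<omega> * Y 0 k + \<nu> k"
    and "\<And>j k. j < \<rho> \<Longrightarrow> Y (Suc j) (Suc k) = \<omega> * Y (Suc j) k + Y j k"
    and "\<And>j. j \<le> \<rho> \<Longrightarrow> Y j 0 = 0"
    and "j \<le> \<rho>"
  shows "Y j k = (\<Sum>l<k. binom_weight j \<omega> (k - Suc l) * \<nu> l)"
  using assms(4)
proof (induction j arbitrary: k)
  case 0
  show ?case
  proof (induction k)
    case (Suc k)
    have "(\<Sum>l<k. binom_weight 0 \<omega> (Suc k - Suc l) * \<nu> l) = (\<Sum>l<k. \<omega> * (binom_weight 0 \<omega> (k - Suc l) * \<nu> l))"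
    proof (rule sum.cong, simp)
      fix l assume "l \<in> {..<k}"
      then have "Suc k - Suc l = Suc (k - Suc l)" by simp
      then show "binom_weight 0 \<omega> (Suc k - Suc l) * \<nu> l = \<omega> * (binom_weight 0 \<omega> (k - Suc l) * \<nu> l)"
        by (simp add: binom_weight_0)
    qed
    then show ?case
      using Suc by (simp add: assms(1) binom_weight_0 sum_distrib_left)
  qed (simp add: assms(3))
next
  case (Suc j)
  then have j: "j < \<rho>" by simp
  show ?case
  proof (induction k)
    case (Suc k)
    have "(\<Sum>l<k. binom_weight (Suc j) \<omega> (Suc k - Suc l) * \<nu> l) =
      (\<Sum>l<k. \<omega> * (binom_weight (Suc j) \<omega> (k - Suc l) * \<nu> l) + binom_weight j \<omega> (k - Suc l) * \<nu> l)"
    proof (rule sum.cong, simp)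
      fix l assume "l \<in> {..<k}"
      then have "Suc k - Suc l = Suc (k - Suc l)" by simp
      then show "binom_weight (Suc j) \<omega> (Suc k - Suc l) * \<nu> l =
          \<omega> * (binom_weight (Suc j) \<omega> (k - Suc l) * \<nu> l) + binom_weight j \<omega> (k - Suc l) * \<nu> l"
        by (simp only: binom_weight_Suc_Suc) (simp add: algebra_simps)
    qed
    then show ?case
      using Suc \<open>\<And>k. j \<le> \<rho> \<Longrightarrow> Y j k = _ k\<close> j
      by (simp add: assms(2) binom_weight_eq_0 sum_distrib_left sum.distrib)
  qed (use Suc.prems in \<open>simp add: assms(3)\<close>)
qed

subsection \<open>Companion dynamics\<close>

text \<open>The polynomial \<open>P\<close> evaluated at the forward shift operator, applied to the
  sequence \<open>s\<close>.\<close>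

definition shift_act :: "real poly \<Rightarrow> (nat \<Rightarrow> real) \<Rightarrow> nat \<Rightarrow> real" where
  "shift_act P s k = (\<Sum>i\<le>degree P. coeff P i * s (k + i))"

lemma shift_act_altdef: "degree P \<le> N \<Longrightarrow> shift_act P s k = (\<Sum>i\<le>N. coeff P i * s (k + i))"
  unfolding shift_act_def by (rule sum.mono_neutral_left) (auto simp: coeff_eq_0)

lemma shift_act_pCons: "shift_act (pCons c P) s k = c * s k + shift_act P s (Suc k)"
  by (subst shift_act_altdef[of _ "Suc (degree P)"])
    (auto simp: shift_act_def degree_pCons_le sum.atMost_Suc_shift simp del: sum.atMost_Suc)

lemma shift_act_add: "shift_act (P + Q) s k = shift_act P s k + shift_act Q s k"
proof -
  let ?N = "max (degree P) (degree Q)"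
  show ?thesis
    by (simp add: shift_act_altdef[of _ ?N] degree_add_le sum.distrib distrib_right)
qed

lemma shift_act_smult: "shift_act (Polynomial.smult c P) s k = c * shift_act P s k"
  by (subst shift_act_altdef[of _ "degree P"])
    (auto simp: shift_act_def degree_smult_le sum_distrib_left mult_ac)

lemma shift_act_1: "shift_act 1 s k = s k"
  by (simp add: shift_act_def)

text \<open>Horner scheme for the monic polynomial with lower coefficients \<open>- g 0\<close>,
  ..., \<open>- g (s - 1)\<close> in descending order. It serves twice: as the characteristic
  polynomial of a companion matrix, and as the operator that expresses coordinate \<open>s\<close>
  of a chain through coordinate 0.\<close>

primrec comp_poly :: "(nat \<Rightarrow> 'a::comm_ring_1) \<Rightarrow> nat \<Rightarrow> 'a poly" where
  "comp_poly g 0 = 1"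
| "comp_poly g (Suc s) = pCons (- g s) (comp_poly g s)"

lemma poly_comp_poly_1: "poly (comp_poly g s) 1 = 1 - (\<Sum>t<s. g t)"
  by (induction s) auto

text \<open>Let P be \<open>comp_poly g (Suc \<rho>)\<close>. Eliminating coordinates turns the
  chain into P(shift) applied to \<open>z 0\<close> equal to \<open>\<nu>\<close>. The sum of all
  \<open>comp_poly g s\<close> with \<open>s \<le> \<rho>\<close> is (P - P(1)) / (X - 1). As P is a
  power of \<open>X - \<omega>\<close>, this quotient is a geometric sum in the powers of
  \<open>X - \<omega>\<close> and of \<open>1 - \<omega>\<close>, and these powers of the shift
  produce the outputs of the filter cascade.\<close>

lemma observer_chain_response:
  fixes z :: "nat \<Rightarrow> nat \<Rightarrow> real"
  assumes step: "\<And>s k. s < \<rho> \<Longrightarrow> z s (Suc k) = z (Suc s) k + g s * z 0 k"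
    and last: "\<And>k. z \<rho> (Suc k) = g \<rho> * z 0 k + \<nu> k"
    and init: "\<And>s. s \<le> \<rho> \<Longrightarrow> z s 0 = 0"
    and cp: "comp_poly g (Suc \<rho>) = [:- \<omega>, 1:] ^ Suc \<rho>"
  shows "(\<Sum>s\<le>\<rho>. z s k) = (\<Sum>l<k. binom_cdf \<rho> \<omega> (k - Suc l) * \<nu> l)"
proof -
  have z: "s \<le> \<rho> \<Longrightarrow> shift_act (comp_poly g s) (z 0) k = z s k" for s k
    by (induction s arbitrary: k) (simp_all add: shift_act_1 shift_act_pCons step)
  have zlast: "shift_act (comp_poly g (Suc \<rho>)) (z 0) k = \<nu> k" for k
    by (simp add: shift_act_pCons z last)
  define y where "y j = shift_act ([:- \<omega>, 1:] ^ j) (z 0)" for j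
  have y_Suc: "y (Suc j) k = y j (Suc k) - \<omega> * y j k" for j k
  proof -
    have "[:- \<omega>, 1:] ^ Suc j = Polynomial.smult (- \<omega>) ([:- \<omega>, 1:] ^ j) + pCons 0 ([:- \<omega>, 1:] ^ j)"
      by simp
    then show ?thesis
      unfolding y_def by (simp only: shift_act_add shift_act_smult shift_act_pCons)
  qed
  have y_last: "y (Suc \<rho>) k = \<nu> k" for k
    using zlast by (simp only: y_def cp)
  \<comment> \<open>The input enters at position \<open>\<rho>\<close> and moves down one position
    per step, so it has not yet reached position \<open>s\<close>. This supplies the zero initial
    values of the cascade, since \<open>y j 0\<close> involves \<open>z 0\<close> up to time
    \<open>j\<close>.\<close>
  have z0: "s + k \<le> \<rho> \<Longrightarrow> z s k = 0" for s k
  proof (induction k arbitrary: s)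
    case (Suc k)
    then show ?case using step[of s k] by simp
  qed (simp add: init)
  have y0: "j + k \<le> \<rho> \<Longrightarrow> y j k = 0" for j k
  proof (induction j arbitrary: k)
    case 0
    then show ?case by (simp add: y_def shift_act_1 z0)
  next
    case (Suc j)
    then show ?case using y_Suc[of j k] by simp
  qed
  \<comment> \<open>The cascade runs downwards in the exponent: \<open>y (Suc \<rho>)\<close> is the
    input, and each lower index adds one filter.\<close>
  have Y: "y (\<rho> - j) k = (\<Sum>l<k. binom_weight j \<omega> (k - Suc l) * \<nu> l)" if "j \<le> \<rho>" for j k
    using that
  proof (rule binom_weight_response[where Y = "\<lambda>j. y (\<rho> - j)", rotated 3])
    show "y (\<rho> - 0) (Suc k) = \<omega> * y (\<rho> - 0) k + \<nu> k" for k
      using y_Suc[of \<rho> k] y_last[of k] by simp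
    show "y (\<rho> - Suc j) (Suc k) = \<omega> * y (\<rho> - Suc j) k + y (\<rho> - j) k" if "j < \<rho>" for j k
      using y_Suc[of "\<rho> - Suc j" k] that by (simp add: Suc_diff_Suc)
    show "y (\<rho> - j) 0 = 0" for j
      by (simp add: y0)
  qed
  have g: "1 - (\<Sum>t\<le>\<rho>. g t) = (1 - \<omega>) ^ Suc \<rho>"
    using poly_comp_poly_1[of g "Suc \<rho>"] unfolding cp
    by (simp add: lessThan_Suc_atMost algebra_simps)
  \<comment> \<open>The quotient identity in time-domain form: both sides start at 0 and have the
    same increment, \<open>\<nu> k - (1 - \<omega>) ^ Suc \<rho> * z 0 k\<close>. On the right the
    increment telescopes through \<open>W\<close>.\<close>
  have "(\<Sum>s\<le>\<rho>. z s k) = (\<Sum>j\<le>\<rho>. (1 - \<omega>) ^ (\<rho> - j) * y j k)" for k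
  proof (induction k)
    case 0
    then show ?case by (simp add: init y0)
  next
    case (Suc k)
    have "(\<Sum>s\<le>\<rho>. z s (Suc k)) = (\<Sum>s<\<rho>. z (Suc s) k + g s * z 0 k) + g \<rho> * z 0 k + \<nu> k"
      by (simp add: lessThan_Suc_atMost[symmetric] step last)
    also have "\<dots> = (\<Sum>s\<le>\<rho>. z s k) - z 0 k + (\<Sum>s\<le>\<rho>. g s) * z 0 k + \<nu> k"
      using sum.lessThan_Suc_shift[of "\<lambda>s. z s k" \<rho>]
      by (simp add: lessThan_Suc_atMost[symmetric] sum.distrib sum_distrib_right[symmetric] algebra_simps)
    also have "\<dots> = (\<Sum>s\<le>\<rho>. z s k) - (1 - \<omega>) ^ Suc \<rho> * z 0 k + \<nu> k"
      unfolding g[symmetric] by (simp add: algebra_simps)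
    finally have L: "(\<Sum>s\<le>\<rho>. z s (Suc k)) = (\<Sum>s\<le>\<rho>. z s k) - (1 - \<omega>) ^ Suc \<rho> * z 0 k + \<nu> k" .
    define W where "W j = (1 - \<omega>) ^ (Suc \<rho> - j) * y j k" for j
    have "(\<Sum>j\<le>\<rho>. (1 - \<omega>) ^ (\<rho> - j) * y j (Suc k)) =
        (\<Sum>j\<le>\<rho>. (1 - \<omega>) ^ (\<rho> - j) * y j k + (W (Suc j) - W j))"
    proof (rule sum.cong, simp)
      fix j assume "j \<in> {..\<rho>}"
      then have *: "(1 - \<omega>) ^ (Suc \<rho> - j) = (1 - \<omega>) * (1 - \<omega>) ^ (\<rho> - j)"
        by (simp add: Suc_diff_le)
      have **: "y j (Suc k) = \<omega> * y j k + y (Suc j) k"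
        using y_Suc[of j k] by simp
      show "(1 - \<omega>) ^ (\<rho> - j) * y j (Suc k) = (1 - \<omega>) ^ (\<rho> - j) * y j k + (W (Suc j) - W j)"
        unfolding W_def * ** diff_Suc_Suc by (simp add: algebra_simps)
    qed
    also have "\<dots> = (\<Sum>j\<le>\<rho>. (1 - \<omega>) ^ (\<rho> - j) * y j k) + (W (Suc \<rho>) - W 0)"
      by (simp only: sum.distrib lessThan_Suc_atMost[symmetric] sum_lessThan_telescope)
    finally show ?case
      using Suc L y_last[of k] by (simp add: W_def y_def shift_act_1)
  qed
  also have "(\<Sum>j\<le>\<rho>. (1 - \<omega>) ^ (\<rho> - j) * y j k) = (\<Sum>j\<le>\<rho>. (1 - \<omega>) ^ j * y (\<rho> - j) k)"
    by (rule sum.reindex_bij_witness[of _ "\<lambda>j. \<rho> - j" "\<lambda>j. \<rho> - j"]) auto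
  also have "\<dots> = (\<Sum>j\<le>\<rho>. \<Sum>l<k. (1 - \<omega>) ^ j * binom_weight j \<omega> (k - Suc l) * \<nu> l)"
    by (simp add: Y sum_distrib_left mult.assoc)
  also have "\<dots> = (\<Sum>l<k. binom_cdf \<rho> \<omega> (k - Suc l) * \<nu> l)"
    unfolding binom_cdf_def sum_distrib_right by (rule sum.swap)
  finally show ?thesis .
qed

text \<open>The summand \<open>l = k\<close> drops because the response at time 0 is 0; what remains
  is shifted by one step.\<close>

lemma conv_impulse_resp:
  "conv (impulse_resp \<rho> \<omega>) s k = (\<Sum>l<k. binom_cdf \<rho> \<omega> (k - Suc l) * s l)"
proof -
  have "conv (impulse_resp \<rho> \<omega>) s k = (\<Sum>l<k. impulse_resp \<rho> \<omega> (k - l) * s l)"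
    by (simp add: conv_def lessThan_Suc_atMost[symmetric] impulse_resp_0)
  also have "\<dots> = (\<Sum>l<k. binom_cdf \<rho> \<omega> (k - Suc l) * s l)"
    by (rule sum.cong) (auto simp: impulse_resp_Suc[symmetric] Suc_diff_Suc)
  finally show ?thesis .
qed

lemma conv_impulse_resp_single:
  assumes "\<And>l. l \<noteq> k0 \<Longrightarrow> s l = 0"
  shows "conv (impulse_resp \<rho> \<omega>) s (Suc (k0 + N)) = binom_cdf \<rho> \<omega> N * s k0"
proof -
  have "conv (impulse_resp \<rho> \<omega>) s (Suc (k0 + N)) =
      (\<Sum>l<Suc (k0 + N). if l = k0 then binom_cdf \<rho> \<omega> N * s k0 else 0)"
    unfolding conv_impulse_resp by (rule sum.cong) (auto simp: assms)
  then show ?thesis by simp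
qed

text \<open>Laplace expansion along the last row meets only the first and the last column. Deleting
  the last row and column leaves a smaller matrix of the same shape. Deleting the last row and the
  first column leaves a lower triangular matrix with diagonal -1, whose determinant cancels the
  cofactor sign.\<close>

lemma char_poly_companion:
  fixes F :: "'a::comm_ring_1 mat"
  assumes "F \<in> carrier_mat n n"
    and "\<And>s t. s < n \<Longrightarrow> Suc t < n \<Longrightarrow> F $$ (s, Suc t) = (if s = t then 1 else 0)"
    and "\<And>s. s < n \<Longrightarrow> F $$ (s, 0) = g s"
  shows "char_poly F = comp_poly g n"
  using assms
proof (induction n arbitrary: F)
  case 0
  then show ?case by (simp add: char_poly_defs det_dim_zero)
next
  case (Suc n)
  let ?M = "char_poly_matrix F"
  have M: "?M \<in> carrier_mat (Suc n) (Suc n)" using Suc.prems by simp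
  have ent: "?M $$ (s, t) = (if s = t then [:0, 1:] else 0) - [:F $$ (s, t):]" if "s < Suc n" "t < Suc n" for s t
    using that Suc.prems(1) by (auto simp: char_poly_matrix_def)
  let ?F' = "mat n n (\<lambda>(s, t). F $$ (s, t))"
  have F': "char_poly ?F' = comp_poly g n"
    by (rule Suc.IH) (auto simp: Suc.prems)
  have del_n: "mat_delete ?M n n = char_poly_matrix ?F'"
    using Suc.prems(1)
    by (intro eq_matI) (auto simp: mat_delete_def ent insert_index_def char_poly_matrix_def)
  have cof_n: "cofactor ?M n n = comp_poly g n"
    using F' by (simp add: cofactor_def del_n char_poly_def)
  show ?case
  \<comment> \<open>For size 1 the first and the last column coincide, so the two-term expansion
    does not apply.\<close>
  proof (cases "n = 0")
    case True
    then show ?thesis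
      unfolding char_poly_def laplace_expansion_row[OF M lessI]
      using cof_n by (simp add: ent Suc.prems(3))
  next
    case False
    have N: "mat_delete ?M n 0 \<in> carrier_mat n n"
      using mat_delete_carrier[OF M] by simp
    have N_ent: "mat_delete ?M n 0 $$ (s, t) = (if s = Suc t then [:0, 1:] else if s = t then - 1 else 0)"
      if "s < n" "t < n" for s t
      using that M by (auto simp: mat_delete_def ent Suc.prems(2) one_pCons)
    have "det (mat_delete ?M n 0) = prod_list (diag_mat (mat_delete ?M n 0))"
      by (rule det_lower_triangular[OF _ N]) (simp add: N_ent)
    also have "diag_mat (mat_delete ?M n 0) = map (\<lambda>_. - 1) [0..<n]"
      using N by (auto simp: diag_mat_def N_ent)
    finally have det: "det (mat_delete ?M n 0) = (- 1) ^ n"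
      by (simp add: map_replicate_const)
    have cof_0: "cofactor ?M n 0 = 1"
      by (simp add: cofactor_def det flip: power_add)
    have "char_poly F = (\<Sum>t<Suc n. ?M $$ (n, t) * cofactor ?M n t)"
      unfolding char_poly_def by (rule laplace_expansion_row[OF M lessI])
    also have "\<dots> = ?M $$ (n, 0) * cofactor ?M n 0 + ?M $$ (n, n) * cofactor ?M n n"
    proof -
      have "(\<Sum>t<Suc n. ?M $$ (n, t) * cofactor ?M n t) = (\<Sum>t\<in>{0, n}. ?M $$ (n, t) * cofactor ?M n t)"
      proof (rule sum.mono_neutral_right)
        show "\<forall>t\<in>{..<Suc n} - {0, n}. ?M $$ (n, t) * cofactor ?M n t = 0"
        proof
          fix t assume t: "t \<in> {..<Suc n} - {0, n}"
          then obtain t' where "t = Suc t'" by (cases t) auto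
          then show "?M $$ (n, t) * cofactor ?M n t = 0"
            using t by (simp add: ent Suc.prems(2))
        qed
      qed auto
      then show ?thesis using False by simp
    qed
    moreover have "F $$ (n, n) = 0"
      using False Suc.prems(2)[of n "n - 1"] by simp
    ultimately show ?thesis
      using False by (simp add: ent Suc.prems cof_0 cof_n)
  qed
qed

subsection \<open>Block indices\<close>

lemma length_block_index: "length (block_index p r) = (\<Sum>i<p. r i + 1)"
  by (induction p) (auto simp: block_index_def)

lemma block_index_Suc: "block_index (Suc p) r = block_index p r @ map (Pair p) [0..<r p + 1]"
  by (simp add: block_index_def)

lemma set_block_index: "set (block_index p r) = {(i, s). i < p \<and> s \<le> r i}"
  by (force simp: block_index_def simp del: upt_Suc)

lemma distinct_block_index: "distinct (block_index p r)"
proof (induction p)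
  case (Suc p)
  have "distinct (map (Pair p) [0..<r p + 1])"
    by (subst distinct_map) (auto simp: inj_on_def)
  then show ?case
    using Suc unfolding block_index_Suc distinct_append by (auto simp: set_block_index)
qed (simp add: block_index_def)

lemma sum_block_index:
  "(\<Sum>v<length (block_index p r). g (block_index p r ! v)) = (\<Sum>i<p. \<Sum>s\<le>r i. g (i, s))"
proof -
  have "(\<Sum>v<length (block_index p r). g (block_index p r ! v)) = sum_list (map g (block_index p r))"
    by (simp add: sum_list_sum_nth lessThan_atLeast0)
  also have "\<dots> = (\<Sum>i<p. \<Sum>s\<le>r i. g (i, s))"
  proof (induction p)
    case (Suc p)
    have "sum_list (map g (map (Pair p) [0..<r p + 1])) = (\<Sum>s\<le>r p. g (p, s))"
      by (simp add: comp_def lessThan_Suc_atMost[symmetric] lessThan_atLeast0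
          interv_sum_list_conv_sum_set_nat del: upt_Suc)
    with Suc show ?case
      unfolding block_index_Suc map_append sum_list_append by simp
  qed (simp add: block_index_def)
  finally show ?thesis .
qed

lemma diag_block_mat_index:
  assumes "\<And>i. i < p \<Longrightarrow> F i \<in> carrier_mat (r i + 1) (r i + 1)"
    and "v < length (block_index p r)" "block_index p r ! v = (i, s)"
    and "w < length (block_index p r)" "block_index p r ! w = (j, t)"
  shows "diag_block_mat (map F [0..<p]) $$ (v, w) = (if i = j then F i $$ (s, t) else 0)"
  using assms
proof (induction p arbitrary: v w)
  case 0
  then show ?case by (simp add: block_index_def)
next
  case (Suc p)
  let ?B = "block_index p r" and ?D = "diag_block_mat (map F [0..<p])"
  have "dim_row (F i) = r i + 1 \<and> dim_col (F i) = r i + 1" if "i < p" for i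
    using Suc.prems(1)[of i] that by auto
  then have dims: "dim_row ?D = length ?B" "dim_col ?D = length ?B"
    by (auto simp: dim_diag_block_mat length_block_index comp_def interv_sum_list_conv_sum_set_nat
        lessThan_atLeast0 simp del: sum.op_ivl_Suc intro!: sum.cong)
  have Fp: "dim_row (F p) = r p + 1" "dim_col (F p) = r p + 1"
    using Suc.prems(1)[of p] by auto
  have low: "i' < p" if "v' < length ?B" "?B ! v' = (i', s')" for v' i' s'
    using nth_mem[OF that(1)] that(2) by (simp add: set_block_index)
  have v: "v < length ?B \<and> ?B ! v = (i, s) \<or> length ?B \<le> v \<and> i = p \<and> s = v - length ?B \<and> s < r p + 1"
    using Suc.prems(2,3) by (auto simp: block_index_Suc nth_append split: if_splits simp del: upt_Suc)
  have w: "w < length ?B \<and> ?B ! w = (j, t) \<or> length ?B \<le> w \<and> j = p \<and> t = w - length ?B \<and> t < r p + 1"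
    using Suc.prems(4,5) by (auto simp: block_index_Suc nth_append split: if_splits simp del: upt_Suc)
  have "v < length ?B + (r p + 1)" "w < length ?B + (r p + 1)"
    using Suc.prems(2,4) by (auto simp: block_index_Suc)
  then have "diag_block_mat (map F [0..<Suc p]) $$ (v, w) =
     (if v < length ?B then if w < length ?B then ?D $$ (v, w) else 0
      else if w < length ?B then 0 else F p $$ (v - length ?B, w - length ?B))"
    by (simp add: diag_block_mat_last Let_def dims Fp)
  then show ?case
    using v w Suc.IH[of v w] Suc.prems(1) low by auto
qed

lemma mult_mat_vec_index_sum:
  "M \<in> carrier_mat nr nc \<Longrightarrow> w \<in> carrier_vec nc \<Longrightarrow> i < nr \<Longrightarrow>
    (M *\<^sub>v w) $ i = (\<Sum>l<nc. M $$ (i, l) * w $ l)"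
  by (simp add: scalar_prod_def lessThan_atLeast0)

subsection \<open>Observer coordinates\<close>

text \<open>Poles and gain \<open>L\<close> stay outside the locale: claim (ii) compares observers
  with different poles for one plant and one transformation \<open>T\<close>.\<close>

locale decoupled_plant =
  fixes n p :: nat and r :: "nat \<Rightarrow> nat" and A0 E0 C0 :: "real mat"
    and a b :: "nat \<Rightarrow> nat \<Rightarrow> nat \<Rightarrow> real"
  assumes A0 [simp]: "A0 \<in> carrier_mat n n"
    and E0 [simp]: "E0 \<in> carrier_mat n p"
    and C0 [simp]: "C0 \<in> carrier_mat p n"
    and r_pos: "i < p \<Longrightarrow> 0 < r i"
    and rel_deg: "relative_degree_condition n p r A0 E0 C0"
    and coeffs: "canonical_coeffs n p r A0 C0 a b"
    and diag: "diagonal_mat (gain_mat p r A0 E0 C0)"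
begin

abbreviation "A \<equiv> aug_A n p A0 E0"
abbreviation "C \<equiv> aug_C p C0"
abbreviation "Cb0 \<equiv> C_bar n p r C0 a"
abbreviation "Cb \<equiv> pad_cols p Cb0"
abbreviation "T \<equiv> T_mat n p r A0 E0 C0 a b"
abbreviation "bi \<equiv> block_index p r"
abbreviation "d \<equiv> d_coeff r b"

definition gain :: "nat \<Rightarrow> real" where
  "gain i = gain_mat p r A0 E0 C0 $$ (i, i)"

definition out :: "nat \<Rightarrow> nat \<Rightarrow> real vec \<Rightarrow> real" where
  "out i \<kappa> e = ((Cb * A ^\<^sub>m \<kappa>) *\<^sub>v e) $ i"

text \<open>The coordinate of \<open>T *\<^sub>v e\<close> at position \<open>s\<close> of block \<open>i\<close>, extended to \<open>s = r i + 1\<close>.\<close>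

definition coord :: "nat \<Rightarrow> nat \<Rightarrow> real vec \<Rightarrow> real" where
  "coord i s e = out i s e - (\<Sum>j<p. \<Sum>t<s. d i j (r i + 1 - s + t) * out j t e)"

text \<open>A vanishing diagonal entry of a diagonal matrix gives a zero row, which excludes a right
  inverse.\<close>

lemma gain_nonzero:
  assumes "i < p"
  shows "gain i \<noteq> 0"
proof
  assume z: "gain i = 0"
  let ?V = "gain_mat p r A0 E0 C0"
  have V: "?V \<in> carrier_mat p p" by (simp add: gain_mat_def)
  obtain B where B: "?V * B = 1\<^sub>m p" and "B * ?V = 1\<^sub>m (dim_row B)"
    using rel_deg V unfolding relative_degree_condition_def invertible_mat_def inverts_mat_def by auto
  then have dB: "dim_row B = p" "dim_col B = p"
    using V by (metis carrier_matD(2) index_mult_mat(3) index_one_mat(3))+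
  have "?V $$ (i, j) = 0" if "j < p" for j
    using z diag V assms that unfolding diagonal_mat_def gain_def by (cases "i = j") auto
  then have "(?V * B) $$ (i, i) = 0"
    using V dB assms by (simp add: scalar_prod_def)
  then show False using B assms by simp
qed

lemma Cb0_carrier [simp]: "Cb0 \<in> carrier_mat p n"
  by (simp add: C_bar_def)

lemma A_carrier [simp]: "A \<in> carrier_mat (n + p) (n + p)"
  unfolding aug_A_def by (intro four_block_carrier_mat) auto

lemma pad_carrier: "M \<in> carrier_mat q n \<Longrightarrow> pad_cols p M \<in> carrier_mat q (n + p)"
  unfolding pad_cols_def using four_block_carrier_mat[of M q n "0\<^sub>m 0 p" 0 p] by auto

lemma Cb_carrier [simp]: "Cb \<in> carrier_mat p (n + p)"
  by (simp add: pad_carrier)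

lemma C_carrier [simp]: "C \<in> carrier_mat p (n + p)"
  by (simp add: aug_C_def pad_carrier)

lemma CbA_carrier [simp]: "Cb * A ^\<^sub>m \<kappa> \<in> carrier_mat p (n + p)"
  by (rule mult_carrier_mat[OF Cb_carrier]) simp

lemma A_append:
  "x \<in> carrier_vec n \<Longrightarrow> f \<in> carrier_vec p \<Longrightarrow> A *\<^sub>v (x @\<^sub>v f) = (A0 *\<^sub>v x + E0 *\<^sub>v f) @\<^sub>v f"
  unfolding aug_A_def by (subst four_block_mat_mult_vec[of _ n n _ p _ p]) auto

lemma pad_append:
  assumes "M \<in> carrier_mat q n" "x \<in> carrier_vec n" "f \<in> carrier_vec p"
  shows "pad_cols p M *\<^sub>v (x @\<^sub>v f) = M *\<^sub>v x"
proof -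
  have "pad_cols p M *\<^sub>v (x @\<^sub>v f) =
      (M *\<^sub>v x + 0\<^sub>m q p *\<^sub>v f) @\<^sub>v (0\<^sub>m 0 n *\<^sub>v x + 0\<^sub>m 0 p *\<^sub>v f)"
    unfolding pad_cols_def using assms
    by (subst four_block_mat_mult_vec[of _ q n _ p _ 0]) auto
  then show ?thesis using assms by (intro eq_vecI) auto
qed

lemma out_0: "x \<in> carrier_vec n \<Longrightarrow> f \<in> carrier_vec p \<Longrightarrow> out i 0 (x @\<^sub>v f) = (Cb0 *\<^sub>v x) $ i"
  using Cb_carrier A_carrier by (simp add: out_def pad_append[OF Cb0_carrier] carrier_matD[OF A_carrier]
      right_mult_one_mat[OF Cb_carrier])

lemma pow_Suc_vec:
  "M \<in> carrier_mat k k \<Longrightarrow> N \<in> carrier_mat q k \<Longrightarrow> w \<in> carrier_vec k \<Longrightarrow>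
    (N * M ^\<^sub>m Suc \<kappa>) *\<^sub>v w = (N * M ^\<^sub>m \<kappa>) *\<^sub>v (M *\<^sub>v w)"
  by (simp add: assoc_mult_mat[symmetric, of _ q k _ k _ k] assoc_mult_mat_vec[of _ q k _ k]
      mult_carrier_mat[of _ q k])

lemma out_Suc: "e \<in> carrier_vec (n + p) \<Longrightarrow> out i (Suc \<kappa>) e = out i \<kappa> (A *\<^sub>v e)"
  unfolding out_def by (subst pow_Suc_vec[OF A_carrier Cb_carrier]) auto

lemma out_add:
  "e \<in> carrier_vec (n + p) \<Longrightarrow> e' \<in> carrier_vec (n + p) \<Longrightarrow> i < p \<Longrightarrow>
    out i \<kappa> (e + e') = out i \<kappa> e + out i \<kappa> e'"
  unfolding out_def by (subst mult_add_distrib_mat_vec[OF CbA_carrier]) (auto simp: carrier_matD[OF Cb_carrier])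

lemma coord_add:
  assumes "e \<in> carrier_vec (n + p)" "e' \<in> carrier_vec (n + p)" "i < p"
  shows "coord i s (e + e') = coord i s e + coord i s e'"
proof -
  have "(\<Sum>j<p. \<Sum>t<s. d i j (r i + 1 - s + t) * out j t (e + e')) =
    (\<Sum>j<p. \<Sum>t<s. d i j (r i + 1 - s + t) * out j t e) +
    (\<Sum>j<p. \<Sum>t<s. d i j (r i + 1 - s + t) * out j t e')"
    unfolding sum.distrib[symmetric] using assms
    by (intro sum.cong) (auto simp: out_add distrib_left)
  then show ?thesis using assms by (simp add: coord_def out_add)
qed

lemma out_state:
  assumes "x \<in> carrier_vec n"
  shows "out i \<kappa> (x @\<^sub>v 0\<^sub>v p) = ((Cb0 * A0 ^\<^sub>m \<kappa>) *\<^sub>v x) $ i"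
  using assms
proof (induction \<kappa> arbitrary: x)
  case 0
  then show ?case by (simp add: out_0 carrier_matD[OF A0] right_mult_one_mat[OF Cb0_carrier])
next
  case (Suc \<kappa>)
  have "E0 *\<^sub>v 0\<^sub>v p = 0\<^sub>v n" by (intro eq_vecI) (auto simp: carrier_matD[OF E0])
  then have "out i (Suc \<kappa>) (x @\<^sub>v 0\<^sub>v p) = out i \<kappa> ((A0 *\<^sub>v x) @\<^sub>v 0\<^sub>v p)"
    using Suc.prems mult_mat_vec_carrier[OF A0 Suc.prems] by (simp add: out_Suc A_append)
  also have "\<dots> = ((Cb0 * A0 ^\<^sub>m Suc \<kappa>) *\<^sub>v x) $ i"
    using Suc.prems Suc.IH[OF mult_mat_vec_carrier[OF A0 Suc.prems]]
    by (simp only: pow_Suc_vec[OF A0 Cb0_carrier])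
  finally show ?case .
qed

text \<open>The augmented model keeps f constant, so one step changes only the plant part.
  Increments of outputs are therefore outputs of undisturbed states, where the canonical relation
  applies.\<close>

lemma out_increment:
  assumes "x \<in> carrier_vec n" "f \<in> carrier_vec p" "i < p"
  shows "out i (Suc \<kappa>) (x @\<^sub>v f) = out i \<kappa> (x @\<^sub>v f) + out i \<kappa> ((A0 *\<^sub>v x + E0 *\<^sub>v f - x) @\<^sub>v 0\<^sub>v p)"
proof -
  have c: "A0 *\<^sub>v x \<in> carrier_vec n" "E0 *\<^sub>v f \<in> carrier_vec n"
    using assms by (auto intro: mult_mat_vec_carrier[OF A0] mult_mat_vec_carrier[OF E0])
  have "x + (w - x) = w" if "w \<in> carrier_vec n" for w
    using assms(1) that by (intro eq_vecI) auto
  from this[of "A0 *\<^sub>v x + E0 *\<^sub>v f"]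
  have "x + (A0 *\<^sub>v x + E0 *\<^sub>v f - x) = A0 *\<^sub>v x + E0 *\<^sub>v f"
    using c by simp
  then have "A *\<^sub>v (x @\<^sub>v f) = (x @\<^sub>v f) + ((A0 *\<^sub>v x + E0 *\<^sub>v f - x) @\<^sub>v 0\<^sub>v p)"
    using assms by (subst append_vec_add[of _ n _ _ p]) (auto simp: A_append intro!: c minus_carrier_vec add_carrier_vec)
  then show ?thesis
    using assms c by (simp add: out_Suc out_add)
qed

section \<open>Markov parameters from the disturbance to the outputs\<close>

lemma markov_C0:
  assumes "l < p" "j < p" "\<kappa> < r l"
  shows "(C0 * (A0 ^\<^sub>m \<kappa> * E0)) $$ (l, j) = (if \<kappa> = r l - 1 \<and> l = j then gain l else 0)"
proof -
  have "col (A0 ^\<^sub>m \<kappa> * E0) j = A0 ^\<^sub>m \<kappa> *\<^sub>v col E0 j"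
    using assms(2) by (intro col_mult2[of _ n n _ p]) auto
  then have *: "(C0 * (A0 ^\<^sub>m \<kappa> * E0)) $$ (l, j) = row C0 l \<bullet> (A0 ^\<^sub>m \<kappa> *\<^sub>v col E0 j)"
    using assms by (simp add: carrier_matD[OF C0] carrier_matD[OF E0])
  show ?thesis
  proof (cases "\<kappa> = r l - 1")
    case True
    have "row C0 l \<bullet> (A0 ^\<^sub>m \<kappa> *\<^sub>v col E0 j) = gain_mat p r A0 E0 C0 $$ (l, j)"
      using assms True by (simp add: gain_mat_def)
    then show ?thesis
      using True * diag assms by (auto simp: gain_def diagonal_mat_def gain_mat_def)
  next
    case False
    then have "\<kappa> < r l - 1" using assms by simp
    then show ?thesis
      using rel_deg assms False * unfolding relative_degree_condition_def by auto
  qed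
qed

lemma Cb0_mult_index:
  assumes X: "X \<in> carrier_mat n q" and "i < p" "l < q"
  shows "(Cb0 * X) $$ (i, l) = (C0 * X) $$ (i, l) - (\<Sum>j<i. a i j (r i) * (C0 * X) $$ (j, l))"
proof -
  have ent: "(M * X) $$ (j, l) = (\<Sum>h<n. M $$ (j, h) * X $$ (h, l))"
    if "M \<in> carrier_mat p n" "j < p" for M j
    using that assms by (simp add: scalar_prod_def lessThan_atLeast0)
  have "(Cb0 * X) $$ (i, l) = (\<Sum>h<n. C0 $$ (i, h) * X $$ (h, l) -
      (\<Sum>j<i. a i j (r i) * (C0 $$ (j, h) * X $$ (h, l))))"
    using assms(2) unfolding ent[OF Cb0_carrier assms(2)]
    by (intro sum.cong) (auto simp: C_bar_def left_diff_distrib sum_distrib_right mult.assoc)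
  also have "\<dots> = (\<Sum>h<n. C0 $$ (i, h) * X $$ (h, l)) -
      (\<Sum>j<i. \<Sum>h<n. a i j (r i) * (C0 $$ (j, h) * X $$ (h, l)))"
    unfolding sum_subtractf by (subst sum.swap) simp
  also have "\<dots> = (C0 * X) $$ (i, l) - (\<Sum>j<i. a i j (r i) * (C0 * X) $$ (j, l))"
    using assms(2) by (simp add: ent[OF C0] sum_distrib_left del: index_mult_mat)
  finally show ?thesis .
qed

text \<open>
  The correction \<open>a i j (r i)\<close> in \<open>Cb0\<close> vanishes unless \<open>r i < r j\<close>, and then output \<open>j\<close> reacts
  to the disturbance later than output \<open>i\<close>.
\<close>

lemma markov:
  assumes "i < p" "f \<in> carrier_vec p" "\<kappa> < r i"
  shows "((Cb0 * A0 ^\<^sub>m \<kappa>) *\<^sub>v (E0 *\<^sub>v f)) $ i = (if \<kappa> = r i - 1 then gain i * f $ i else 0)"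
proof -
  let ?X = "A0 ^\<^sub>m \<kappa> * E0"
  have X: "?X \<in> carrier_mat n p" by (rule mult_carrier_mat[of _ n n]) auto
  have ent: "(Cb0 * ?X) $$ (i, j) = (if \<kappa> = r i - 1 \<and> i = j then gain i else 0)" if "j < p" for j
  proof -
    have "a i l (r i) * (C0 * ?X) $$ (l, j) = 0" if "l < i" for l
    proof (cases "r i < r l")
      case True
      then have "\<kappa> < r l" "\<kappa> \<noteq> r l - 1" using assms(3) by auto
      then show ?thesis
        using markov_C0[of l j \<kappa>] \<open>j < p\<close> that assms(1) by (simp del: index_mult_mat)
    next
      case False
      then have "a i l (r i) = 0"
        using coeffs that assms(1) unfolding canonical_coeffs_def by auto
      then show ?thesis by simp
    qed
    then have "(\<Sum>l<i. a i l (r i) * (C0 * ?X) $$ (l, j)) = 0"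
      by (intro sum.neutral) blast
    then show ?thesis
      using Cb0_mult_index[OF X assms(1) that] markov_C0[OF assms(1) that assms(3)]
      by (simp del: index_mult_mat)
  qed
  have "(Cb0 * A0 ^\<^sub>m \<kappa>) *\<^sub>v (E0 *\<^sub>v f) = (Cb0 * ?X) *\<^sub>v f"
    using assms(2) by (subst assoc_mult_mat_vec[symmetric, of _ p n _ p])
      (auto intro!: mult_carrier_mat[of _ p n] simp: assoc_mult_mat[of _ p n _ n _ p])
  also have "\<dots> $ i = (\<Sum>j<p. (Cb0 * ?X) $$ (i, j) * f $ j)"
    using assms by (intro mult_mat_vec_index_sum[of _ p]) (auto intro!: mult_carrier_mat[OF Cb0_carrier X])
  also have "\<dots> = (\<Sum>j<p. if j = i then if \<kappa> = r i - 1 then gain i * f $ i else 0 else 0)"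
    by (rule sum.cong) (auto simp: ent simp del: index_mult_mat)
  also have "\<dots> = (if \<kappa> = r i - 1 then gain i * f $ i else 0)"
    using assms(1) by simp
  finally show ?thesis .
qed

text \<open>By \<open>out_increment\<close>, raising the order from \<open>\<kappa>\<close> to
  \<open>\<kappa> + 1\<close> adds the Markov parameter of order \<open>\<kappa>\<close>, and the
  first nonzero one has order \<open>r i - 1\<close>.\<close>

lemma out_dist:
  assumes "i < p" "f \<in> carrier_vec p" "\<kappa> \<le> r i"
  shows "out i \<kappa> (0\<^sub>v n @\<^sub>v f) = (if \<kappa> = r i then gain i * f $ i else 0)"
  using assms(3)
proof (induction \<kappa>)
  case 0
  then show ?case
    using assms r_pos[OF assms(1)] by (simp add: out_0 carrier_matD[OF Cb0_carrier])
next
  case (Suc \<kappa>)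
  have E: "E0 *\<^sub>v f \<in> carrier_vec n" using assms(2) mult_mat_vec_carrier[OF E0] by blast
  have "A0 *\<^sub>v 0\<^sub>v n + E0 *\<^sub>v f - 0\<^sub>v n = E0 *\<^sub>v f"
    using E by (intro eq_vecI) (auto simp: carrier_matD[OF A0] carrier_matD[OF E0])
  then have "out i (Suc \<kappa>) (0\<^sub>v n @\<^sub>v f) = out i \<kappa> (0\<^sub>v n @\<^sub>v f) + out i \<kappa> ((E0 *\<^sub>v f) @\<^sub>v 0\<^sub>v p)"
    using out_increment[of "0\<^sub>v n" f i \<kappa>] assms by simp
  then show ?case
    using Suc assms by (auto simp: out_state[OF E] markov)
qed

lemma out_canonical:
  assumes "i < p" "w \<in> carrier_vec n"
  shows "out i (r i) (w @\<^sub>v 0\<^sub>v p) = (\<Sum>j<p. \<Sum>\<kappa><r i. b i j \<kappa> * out j \<kappa> (w @\<^sub>v 0\<^sub>v p))"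
proof -
  have M: "Cb0 * A0 ^\<^sub>m \<kappa> \<in> carrier_mat p n" for \<kappa>
    by (rule mult_carrier_mat[OF Cb0_carrier]) simp
  have o: "out j \<kappa> (w @\<^sub>v 0\<^sub>v p) = (\<Sum>l<n. (Cb0 * A0 ^\<^sub>m \<kappa>) $$ (j, l) * w $ l)" if "j < p" for j \<kappa>
    using out_state[OF assms(2)] mult_mat_vec_index_sum[OF M assms(2) that] by metis
  have "out i (r i) (w @\<^sub>v 0\<^sub>v p) =
      (\<Sum>l<n. \<Sum>j<p. \<Sum>\<kappa><r i. b i j \<kappa> * ((Cb0 * A0 ^\<^sub>m \<kappa>) $$ (j, l) * w $ l))"
    unfolding o[OF assms(1)]
  proof (rule sum.cong)
    fix l assume "l \<in> {..<n}"
    then have "(Cb0 * A0 ^\<^sub>m r i) $$ (i, l) = (\<Sum>j<p. \<Sum>\<kappa><r i. b i j \<kappa> * (Cb0 * A0 ^\<^sub>m \<kappa>) $$ (j, l))"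
      using coeffs assms(1) unfolding canonical_coeffs_def by blast
    then show "(Cb0 * A0 ^\<^sub>m r i) $$ (i, l) * w $ l =
        (\<Sum>j<p. \<Sum>\<kappa><r i. b i j \<kappa> * ((Cb0 * A0 ^\<^sub>m \<kappa>) $$ (j, l) * w $ l))"
      by (simp only: sum_distrib_right mult.assoc)
  qed simp
  also have "\<dots> = (\<Sum>j<p. \<Sum>l<n. \<Sum>\<kappa><r i. b i j \<kappa> * ((Cb0 * A0 ^\<^sub>m \<kappa>) $$ (j, l) * w $ l))"
    by (rule sum.swap)
  also have "\<dots> = (\<Sum>j<p. \<Sum>\<kappa><r i. \<Sum>l<n. b i j \<kappa> * ((Cb0 * A0 ^\<^sub>m \<kappa>) $$ (j, l) * w $ l))"
    by (rule sum.cong[OF refl], rule sum.swap)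
  also have "\<dots> = (\<Sum>j<p. \<Sum>\<kappa><r i. b i j \<kappa> * out j \<kappa> (w @\<^sub>v 0\<^sub>v p))"
    by (intro sum.cong refl) (simp only: o sum_distrib_left lessThan_iff)
  finally show ?thesis .
qed

section \<open>The coefficients \<open>d\<close> and the block coordinates\<close>

lemma b_eq_0: "i < p \<Longrightarrow> j < p \<Longrightarrow> r j \<le> \<kappa> \<or> r i \<le> \<kappa> \<Longrightarrow> b i j \<kappa> = 0"
  using coeffs unfolding canonical_coeffs_def by auto

lemma d_eq_0:
  assumes "i < p" "j < p" "r j < \<kappa>"
  shows "d i j \<kappa> = 0"
proof -
  have "r j \<le> \<kappa> - 1" "r j \<le> \<kappa>" using assms(3) by auto
  then have "b i j (\<kappa> - 1) = 0" "b i j \<kappa> = 0" using b_eq_0 assms by blast+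
  then show ?thesis using assms(3) by (auto simp: d_coeff_def)
qed

lemma sum_d:
  assumes "i < p" "j < p" "t < r i"
  shows "(\<Sum>\<kappa>=Suc t..r i. d i j \<kappa>) = b i j t + (if i = j then 1 else 0)"
proof -
  have "(\<Sum>\<kappa>=Suc t..r i. d i j \<kappa>) =
      (\<Sum>\<kappa>=Suc t..r i. b i j (\<kappa> - 1) - b i j \<kappa>) + (\<Sum>\<kappa>=Suc t..r i. if \<kappa> = r i \<and> i = j then 1 else 0)"
    unfolding sum.distrib[symmetric] by (rule sum.cong) (auto simp: d_coeff_def)
  also have "(\<Sum>\<kappa>=Suc t..r i. b i j (\<kappa> - 1) - b i j \<kappa>) = b i j t - b i j (r i)"
  proof -
    have "(\<Sum>\<kappa>=Suc t..r i. b i j (\<kappa> - 1) - b i j \<kappa>) = (\<Sum>\<kappa>=t..<r i. b i j \<kappa> - b i j (Suc \<kappa>))"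
      by (rule sum.reindex_bij_witness[of _ Suc "\<lambda>\<kappa>. \<kappa> - 1"]) auto
    also have "\<dots> = - (\<Sum>\<kappa>=t..<r i. b i j (Suc \<kappa>) - b i j \<kappa>)"
      by (simp add: sum_negf[symmetric])
    finally show ?thesis using assms(3) by (simp add: sum_Suc_diff')
  qed
  also have "(\<Sum>\<kappa>=Suc t..r i. if \<kappa> = r i \<and> i = j then 1 else 0) = (if i = j then 1 else 0::real)"
    using assms(3) by auto
  finally show ?thesis using assms by (simp add: b_eq_0)
qed

text \<open>Summation by parts turns the \<open>d\<close> combination of outputs into the
  \<open>b\<close> combination of their increments, and on increments the canonical relation holds
  by \<open>out_canonical\<close>.\<close>

lemma coord_end:
  assumes "i < p" "x \<in> carrier_vec n" "f \<in> carrier_vec p"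
  shows "coord i (Suc (r i)) (x @\<^sub>v f) = 0"
proof -
  let ?e = "x @\<^sub>v f" and ?w = "(A0 *\<^sub>v x + E0 *\<^sub>v f - x) @\<^sub>v 0\<^sub>v p"
  have w: "A0 *\<^sub>v x + E0 *\<^sub>v f - x \<in> carrier_vec n"
    using assms by (auto intro!: minus_carrier_vec add_carrier_vec mult_mat_vec_carrier[OF A0] mult_mat_vec_carrier[OF E0])
  have inc: "out j (Suc \<kappa>) ?e = out j \<kappa> ?e + out j \<kappa> ?w" if "j < p" for j \<kappa>
    using out_increment[OF assms(2,3) that] .
  have "(\<Sum>t<Suc (r i). d i j t * out j t ?e) =
      (\<Sum>t<r i. b i j t * out j t ?w) + (if i = j then out i (r i) ?e else 0)" if "j < p" for j
  proof -
    \<comment> \<open>The upper limit is generalised to \<open>q\<close> for the induction; the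
      boundary term vanishes at \<open>q = r i\<close> because
      \<open>b i j (r i) = 0\<close>.\<close>
    have "(\<Sum>t<Suc q. d i j t * out j t ?e) = (\<Sum>t<q. b i j t * out j t ?w) - b i j q * out j q ?e
        + (if i = j \<and> r i \<le> q then out i (r i) ?e else 0)" for q
    proof (induction q)
      case 0
      then show ?case using r_pos[OF assms(1)] by (simp add: d_coeff_def)
    next
      case (Suc q)
      then show ?case
        by (auto simp: d_coeff_def inc[OF that] algebra_simps le_Suc_eq; use inc[OF that, of q] in simp)
    qed
    from this[of "r i"] show ?thesis using b_eq_0[OF assms(1) that] by simp
  qed
  then have "coord i (Suc (r i)) ?e = out i (Suc (r i)) ?e -
      (\<Sum>j<p. (\<Sum>t<r i. b i j t * out j t ?w) + (if i = j then out i (r i) ?e else 0))"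
    by (simp add: coord_def del: sum.lessThan_Suc)
  also have "\<dots> = out i (Suc (r i)) ?e - (out i (r i) ?w + out i (r i) ?e)"
    using assms(1) by (simp add: sum.distrib out_canonical[OF assms(1) w])
  finally show ?thesis using inc[OF assms(1)] by simp
qed

text \<open>A step moves every output one order up; the only terms of \<open>coord i (Suc s)\<close>
  not reached are those of order 0. Hence all coupling between blocks passes through the
  \<open>out j 0\<close>.\<close>

lemma coord_A:
  assumes "i < p" "s \<le> r i" "e \<in> carrier_vec (n + p)"
  shows "coord i s (A *\<^sub>v e) = coord i (Suc s) e + (\<Sum>j<p. d i j (r i - s) * out j 0 e)"
proof -
  have "(\<Sum>t<Suc s. d i j (r i + 1 - Suc s + t) * out j t e) =
      d i j (r i - s) * out j 0 e + (\<Sum>t<s. d i j (r i + 1 - s + t) * out j t (A *\<^sub>v e))" for j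
    unfolding sum.lessThan_Suc_shift using assms(2,3)
    by (simp add: out_Suc Suc_diff_le)
  then show ?thesis
    using assms(3) by (simp add: coord_def out_Suc sum.distrib del: sum.lessThan_Suc)
qed

text \<open>Each correction term vanishes: for \<open>t < r j\<close> the output does not yet see
  the disturbance, and for \<open>t \<ge> r j\<close> the index of \<open>d\<close> exceeds
  \<open>r j\<close>.\<close>

lemma coord_dist:
  assumes "i < p" "s \<le> r i" "f \<in> carrier_vec p"
  shows "coord i s (0\<^sub>v n @\<^sub>v f) = (if s = r i then gain i * f $ i else 0)"
proof -
  have "d i j (r i + 1 - s + t) * out j t (0\<^sub>v n @\<^sub>v f) = 0" if "j < p" for j t
    using assms that d_eq_0[OF assms(1) that] out_dist[OF that assms(3), of t]
    by (cases "t < r j") auto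
  then show ?thesis
    using assms by (simp add: coord_def out_dist)
qed

text \<open>Collecting the corrections by output gives \<open>out j t\<close> the coefficient
  \<open>b i j t\<close>, plus 1 if \<open>i = j\<close>. The ones cancel all outputs of channel
  \<open>i\<close> below order \<open>r i\<close>; the \<open>b\<close> part sees only the plant
  state and equals its output of order \<open>r i\<close>. The difference at order
  \<open>r i\<close> is the contribution of f.\<close>

lemma sum_coord:
  assumes "i < p" "x \<in> carrier_vec n" "f \<in> carrier_vec p"
  shows "(\<Sum>s\<le>r i. coord i s (x @\<^sub>v f)) = gain i * f $ i"
proof -
  let ?e = "x @\<^sub>v f"
  have "x @\<^sub>v f = (x @\<^sub>v 0\<^sub>v p) + (0\<^sub>v n @\<^sub>v f)"
    using assms by (subst append_vec_add[of _ n _ _ p]) auto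
  then have split: "out j \<kappa> ?e = out j \<kappa> (x @\<^sub>v 0\<^sub>v p) + out j \<kappa> (0\<^sub>v n @\<^sub>v f)" if "j < p" for j \<kappa>
    using assms that by (simp add: out_add)
  have b: "b i j t * out j t ?e = b i j t * out j t (x @\<^sub>v 0\<^sub>v p)" if "j < p" for j t
  proof (cases "t < r j")
    case True
    then show ?thesis using split[OF that] out_dist[OF that assms(3), of t] by simp
  qed (simp add: b_eq_0[OF assms(1) that])
  have "(\<Sum>s\<le>r i. \<Sum>t<s. d i j (r i + 1 - s + t) * out j t ?e) =
      (\<Sum>t<r i. (\<Sum>\<kappa>=Suc t..r i. d i j \<kappa>) * out j t ?e)" for j
  proof -
    have "(\<Sum>s\<le>r i. \<Sum>t<s. d i j (r i + 1 - s + t) * out j t ?e) =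
        (\<Sum>(s, t)\<in>Sigma {..r i} lessThan. d i j (r i + 1 - s + t) * out j t ?e)"
      by (rule sum.Sigma) auto
    also have "\<dots> = (\<Sum>(t, \<kappa>)\<in>Sigma {..<r i} (\<lambda>t. {Suc t..r i}). d i j \<kappa> * out j t ?e)"
      by (rule sum.reindex_bij_witness[of _ "\<lambda>(t, \<kappa>). (r i + 1 + t - \<kappa>, t)" "\<lambda>(s, t). (t, r i + 1 - s + t)"])
        auto
    also have "\<dots> = (\<Sum>t<r i. \<Sum>\<kappa>=Suc t..r i. d i j \<kappa> * out j t ?e)"
      by (rule sum.Sigma[symmetric]) auto
    finally show ?thesis by (simp add: sum_distrib_right)
  qed
  then have "(\<Sum>s\<le>r i. coord i s ?e) = (\<Sum>s\<le>r i. out i s ?e) -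
      (\<Sum>j<p. \<Sum>t<r i. (\<Sum>\<kappa>=Suc t..r i. d i j \<kappa>) * out j t ?e)"
    unfolding coord_def sum_subtractf by (subst sum.swap) simp
  also have "\<dots> = (\<Sum>s\<le>r i. out i s ?e) -
      (\<Sum>j<p. (\<Sum>t<r i. b i j t * out j t (x @\<^sub>v 0\<^sub>v p)) + (if i = j then \<Sum>t<r i. out i t ?e else 0))"
  proof -
    have "(\<Sum>t<r i. (\<Sum>\<kappa>=Suc t..r i. d i j \<kappa>) * out j t ?e) =
        (\<Sum>t<r i. b i j t * out j t (x @\<^sub>v 0\<^sub>v p)) + (if i = j then \<Sum>t<r i. out i t ?e else 0)"
      if "j < p" for j
    proof -
      have "(\<Sum>\<kappa>=Suc t..r i. d i j \<kappa>) * out j t ?e =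
          b i j t * out j t (x @\<^sub>v 0\<^sub>v p) + (if i = j then out i t ?e else 0)" if "t < r i" for t
        unfolding sum_d[OF assms(1) \<open>j < p\<close> that] distrib_right b[OF \<open>j < p\<close>] by simp
      then show ?thesis by (simp add: sum.distrib)
    qed
    then show ?thesis by simp
  qed
  also have "\<dots> = out i (r i) ?e - out i (r i) (x @\<^sub>v 0\<^sub>v p)"
    using assms(1) by (simp add: sum.distrib out_canonical[OF assms(1,2)] lessThan_Suc_atMost[symmetric])
  also have "\<dots> = gain i * f $ i"
    using split[OF assms(1)] out_dist[OF assms(1,3), of "r i"] by simp
  finally show ?thesis .
qed

subsection \<open>Invertibility of the transformation\<close>

lemma length_bi [simp]: "length bi = n + p"
  using rel_deg by (simp add: length_block_index relative_degree_condition_def sum_Suc)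

lemma bi_nthE:
  assumes "v < n + p"
  obtains i s where "bi ! v = (i, s)" "i < p" "s \<le> r i"
proof -
  have "bi ! v \<in> {(i, s). i < p \<and> s \<le> r i}"
    using nth_mem[of v bi] assms by (simp add: set_block_index)
  then show thesis using that by blast
qed

lemma bi_index:
  assumes "i < p" "s \<le> r i"
  obtains v where "v < n + p" "bi ! v = (i, s)"
proof -
  have "(i, s) \<in> set bi" using assms by (simp add: set_block_index)
  then show thesis using that by (auto simp: in_set_conv_nth)
qed

lemma bi_inj: "v < n + p \<Longrightarrow> w < n + p \<Longrightarrow> bi ! v = bi ! w \<Longrightarrow> v = w"
  using distinct_block_index[of p r] by (simp add: nth_eq_iff_index_eq)

abbreviation "S \<equiv> S_mat n p r A0 E0 C0 a"
abbreviation "Q1 \<equiv> Q1_mat n p r b"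

lemma S_carrier [simp]: "S \<in> carrier_mat (n + p) (n + p)"
  unfolding S_mat_def using mat_of_rows_carrier(1) by (metis length_map length_bi)

lemma Q1_carrier [simp]: "Q1 \<in> carrier_mat (n + p) (n + p)"
  by (simp add: Q1_mat_def)

lemma T_carrier [simp]: "T \<in> carrier_mat (n + p) (n + p)"
  unfolding T_mat_def by (rule mult_carrier_mat[OF Q1_carrier S_carrier])

lemma S_index:
  assumes "v < n + p" "bi ! v = (i, s)" "e \<in> carrier_vec (n + p)"
  shows "(S *\<^sub>v e) $ v = out i s e"
proof -
  have i: "i < p" using assms(1,2) by (auto elim: bi_nthE)
  have "row S v = row (Cb * A ^\<^sub>m s) i"
    unfolding S_mat_def using assms
    by (subst mat_of_rows_row) (auto intro!: row_carrier_vec[OF i CbA_carrier])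
  then show ?thesis
    using assms i by (simp add: out_def carrier_matD[OF S_carrier] carrier_matD[OF Cb_carrier])
qed

lemma T_index:
  assumes v: "v < n + p" "bi ! v = (i, s)" and e: "e \<in> carrier_vec (n + p)"
  shows "(T *\<^sub>v e) $ v = coord i s e"
proof -
  have is_bounds: "i < p" "s \<le> r i" using v by (auto elim: bi_nthE)
  have Se: "S *\<^sub>v e \<in> carrier_vec (n + p)" using e mult_mat_vec_carrier[OF S_carrier] by blast
  let ?g = "\<lambda>(j, t). (if s > t then - d i j (r i + 1 - s + t) else if i = j \<and> s = t then 1 else 0) * out j t e"
  have "(T *\<^sub>v e) $ v = (Q1 *\<^sub>v (S *\<^sub>v e)) $ v"
    using e by (simp add: T_mat_def assoc_mult_mat_vec[OF Q1_carrier S_carrier])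
  also have "\<dots> = (\<Sum>w<n + p. Q1 $$ (v, w) * (S *\<^sub>v e) $ w)"
    by (rule mult_mat_vec_index_sum[OF Q1_carrier Se v(1)])
  also have "\<dots> = (\<Sum>w<length bi. ?g (bi ! w))"
  proof (rule sum.cong)
    fix w assume "w \<in> {..<length bi}"
    then have w: "w < n + p" by simp
    then obtain j t where jt: "bi ! w = (j, t)" by (cases "bi ! w")
    show "Q1 $$ (v, w) * (S *\<^sub>v e) $ w = ?g (bi ! w)"
      unfolding S_index[OF w jt e] jt using v w jt by (simp add: Q1_mat_def)
  qed simp
  also have "\<dots> = (\<Sum>j<p. \<Sum>t\<le>r j. ?g (j, t))"
    by (rule sum_block_index)
  also have "\<dots> = (\<Sum>j<p. (if i = j then out i s e else 0) - (\<Sum>t<s. d i j (r i + 1 - s + t) * out j t e))"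
  proof (rule sum.cong)
    fix j assume "j \<in> {..<p}"
    then have j: "j < p" by simp
    have "(\<Sum>t\<le>r j. ?g (j, t)) =
        (\<Sum>t\<le>r j. if t = s then if i = j then out i s e else 0 else 0) -
        (\<Sum>t\<le>r j. if t < s then d i j (r i + 1 - s + t) * out j t e else 0)"
      unfolding sum_subtractf[symmetric] by (rule sum.cong) auto
    also have "(\<Sum>t\<le>r j. if t = s then if i = j then out i s e else 0 else 0) = (if i = j then out i s e else 0)"
      using is_bounds by (auto simp: sum.delta)
    also have "(\<Sum>t\<le>r j. if t < s then d i j (r i + 1 - s + t) * out j t e else 0) =
        (\<Sum>t<s. d i j (r i + 1 - s + t) * out j t e)"
    \<comment> \<open>The definition of \<open>coord\<close> also sums positions beyond the end of a
      shorter block \<open>j\<close>, absent from \<open>Q1\<close>; there \<open>d\<close> is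
      0.\<close>
    proof (rule sum.mono_neutral_cong)
      fix t assume "t \<in> {..<s} - {..r j}"
      then show "d i j (r i + 1 - s + t) * out j t e = 0"
        using d_eq_0[OF is_bounds(1) j] is_bounds(2) by auto
    qed auto
    finally show "(\<Sum>t\<le>r j. ?g (j, t)) =
        (if i = j then out i s e else 0) - (\<Sum>t<s. d i j (r i + 1 - s + t) * out j t e)" .
  qed simp
  also have "\<dots> = coord i s e"
    using is_bounds(1) by (simp add: coord_def sum_subtractf)
  finally show ?thesis .
qed

lemma out_funpow:
  "e \<in> carrier_vec (n + p) \<Longrightarrow> out i \<kappa> (((*\<^sub>v) A ^^ l) e) = out i (\<kappa> + l) e"
proof (induction l arbitrary: \<kappa>)
  case (Suc l)
  have "((*\<^sub>v) A ^^ l) e \<in> carrier_vec (n + p)"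
    by (induction l) (auto intro: Suc.prems mult_mat_vec_carrier[OF A_carrier])
  then show ?case
    using Suc.IH[OF Suc.prems, of "Suc \<kappa>"] by (simp add: out_Suc)
qed simp

text \<open>
  A left null vector \<open>\<alpha>\<close> of \<open>S\<close> is orthogonal to \<open>S\<close> applied to the disturbance directions shifted
  by powers of \<open>A\<close>; this annihilates its entries one level at a time, from \<open>\<kappa> = r i\<close> downwards.
\<close>

lemma det_S: "det S \<noteq> 0"
proof
  assume "det S = 0"
  then have "det S\<^sup>T = 0" by (simp add: det_transpose[OF S_carrier])
  then obtain \<alpha> where \<alpha>: "\<alpha> \<in> carrier_vec (n + p)" "\<alpha> \<noteq> 0\<^sub>v (n + p)" "S\<^sup>T *\<^sub>v \<alpha> = 0\<^sub>v (n + p)"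
    using det_0_iff_vec_prod_zero_field[of "S\<^sup>T" "n + p"] by auto
  have orth: "(\<Sum>v<n + p. \<alpha> $ v * (S *\<^sub>v e) $ v) = 0" if "e \<in> carrier_vec (n + p)" for e
  proof -
    have "\<alpha> \<bullet> (S *\<^sub>v e) = (S\<^sup>T *\<^sub>v \<alpha>) \<bullet> e"
      by (rule transpose_vec_mult_scalar[symmetric, OF S_carrier that \<alpha>(1)])
    then show ?thesis
      using that \<alpha> by (simp add: scalar_prod_def lessThan_atLeast0 carrier_matD[OF S_carrier])
  qed
  have zero: "\<alpha> $ v = 0" if "v < n + p" "bi ! v = (i, \<kappa>)" "r i - \<kappa> = l" for v i \<kappa> l
    using that
  proof (induction l arbitrary: v i \<kappa> rule: less_induct)
    case (less l)
    have i: "i < p" "\<kappa> \<le> r i" using less.prems by (auto elim: bi_nthE)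
    define h :: "real vec" where "h = 0\<^sub>v n @\<^sub>v unit_vec p i"
    have h: "h \<in> carrier_vec (n + p)" by (simp add: h_def)
    define e where "e = ((*\<^sub>v) A ^^ l) h"
    have e: "e \<in> carrier_vec (n + p)"
      unfolding e_def by (induction l) (auto intro: h mult_mat_vec_carrier[OF A_carrier])
    have "\<alpha> $ w * (S *\<^sub>v e) $ w = (if w = v then \<alpha> $ v * gain i else 0)" if w: "w < n + p" for w
    proof -
      obtain j t where jt: "bi ! w = (j, t)" "j < p" "t \<le> r j" using w by (rule bi_nthE)
      have "(S *\<^sub>v e) $ w = out j (t + l) h"
        using S_index[OF w jt(1) e] out_funpow[OF h] by (simp add: e_def)
      moreover have "\<alpha> $ w = 0" if "r j < t + l"
        using less.IH[of "r j - t" w j t] w jt that by auto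
      moreover have "out j (t + l) h = (if t + l = r j \<and> j = i then gain i else 0)" if "t + l \<le> r j"
        using out_dist[OF jt(2) _ that, of "unit_vec p i"] jt(2) i(1) by (auto simp: h_def)
      moreover have "w = v \<longleftrightarrow> t + l = r j \<and> j = i" if "t + l \<le> r j"
        using bi_inj[OF w less.prems(1)] jt less.prems i by auto
      moreover have "w \<noteq> v" if "r j < t + l"
        using jt less.prems that by auto
      ultimately show ?thesis by (cases "t + l \<le> r j") auto
    qed
    then have "(\<Sum>w<n + p. if w = v then \<alpha> $ v * gain i else 0) = 0"
      using orth[OF e] by simp
    then show ?case
      using less.prems(1) gain_nonzero[OF i(1)] by simp
  qed
  have "\<alpha> $ v = 0" if "v < n + p" for v
    using zero[OF that] by (cases "bi ! v") blast
  then have "\<alpha> = 0\<^sub>v (n + p)"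
    using \<alpha>(1) by (intro eq_vecI) auto
  with \<alpha>(2) show False by simp
qed

text \<open>In the flat order \<open>Q1\<close> need not be triangular, but ordered by position
  within the block it is unit lower triangular. Null vectors therefore vanish by induction on
  \<open>s\<close>.\<close>

lemma det_Q1: "det Q1 \<noteq> 0"
proof
  assume "det Q1 = 0"
  then obtain y where y: "y \<in> carrier_vec (n + p)" "y \<noteq> 0\<^sub>v (n + p)" "Q1 *\<^sub>v y = 0\<^sub>v (n + p)"
    using det_0_iff_vec_prod_zero_field[OF Q1_carrier] by auto
  have zero: "y $ v = 0" if "v < n + p" "bi ! v = (i, s)" for v i s
    using that
  proof (induction s arbitrary: v i rule: less_induct)
    case (less s)
    have "Q1 $$ (v, w) * y $ w = (if w = v then y $ v else 0)" if w: "w < n + p" for w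
    proof -
      obtain j t where jt: "bi ! w = (j, t)" by (cases "bi ! w")
      show ?thesis
        using less.IH[of t w j] jt w less.prems bi_inj[OF w less.prems(1)]
        by (auto simp: Q1_mat_def)
    qed
    then have "(Q1 *\<^sub>v y) $ v = (\<Sum>w<n + p. if w = v then y $ v else 0)"
      unfolding mult_mat_vec_index_sum[OF Q1_carrier y(1) less.prems(1)] by (intro sum.cong) auto
    then show ?case using y(3) less.prems(1) by simp
  qed
  have "y $ v = 0" if "v < n + p" for v
    using zero[OF that] by (cases "bi ! v") blast
  then have "y = 0\<^sub>v (n + p)"
    using y(1) by (intro eq_vecI) auto
  with y(2) show False by simp
qed

text \<open>This gives meaning to \<open>the (mat_inverse T)\<close> in the decoupling
  condition.\<close>

lemma T_inverse:
  obtains Ti where "mat_inverse T = Some Ti" "Ti \<in> carrier_mat (n + p) (n + p)"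
    "T * Ti = 1\<^sub>m (n + p)" "Ti * T = 1\<^sub>m (n + p)"
proof -
  have "det T \<noteq> 0"
    unfolding T_mat_def by (simp add: det_mult[OF Q1_carrier S_carrier] det_S det_Q1)
  then have "T \<in> Units (ring_mat TYPE(real) (n + p) ())"
    by (rule det_non_zero_imp_unit[OF T_carrier])
  then have "mat_inverse T \<noteq> None"
    using mat_inverse(1)[OF T_carrier, where b = "()"] by blast
  then show thesis
    using that mat_inverse(2)[OF T_carrier] by blast
qed

text \<open>\<open>Cb0\<close> arises from \<open>C0\<close> by a unit lower triangular combination
  of rows, so the original outputs vanish by forward substitution.\<close>

lemma C_null:
  assumes e: "e \<in> carrier_vec (n + p)" and "\<And>j. j < p \<Longrightarrow> out j 0 e = 0"
  shows "C *\<^sub>v e = 0\<^sub>v p"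
proof -
  obtain x f where xf: "x \<in> carrier_vec n" "f \<in> carrier_vec p" "e = x @\<^sub>v f"
    using vec_first_last_append[OF e] by (metis vec_first_carrier vec_last_carrier)
  have "(C0 *\<^sub>v x) $ j = 0" if "j < p" for j
    using that
  proof (induction j rule: less_induct)
    case (less j)
    have X: "mat_of_cols n [x] \<in> carrier_mat n 1"
      using mat_of_cols_carrier(1)[of n "[x]"] by simp
    have "(M * mat_of_cols n [x]) $$ (l, 0) = (M *\<^sub>v x) $ l" if "M \<in> carrier_mat p n" "l < p" for M l
      using that xf(1) by simp
    then have "(Cb0 *\<^sub>v x) $ j = (C0 *\<^sub>v x) $ j - (\<Sum>l<j. a j l (r j) * (C0 *\<^sub>v x) $ l)"
      using Cb0_mult_index[OF X less.prems, of 0] less.prems by (simp del: index_mult_mat_vec index_mult_mat)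
    then show ?case
      using assms(2)[OF less.prems] less xf by (simp add: out_0 del: index_mult_mat_vec)
  qed
  then have "C0 *\<^sub>v x = 0\<^sub>v p"
    by (intro eq_vecI) (auto simp: carrier_matD[OF C0])
  then show ?thesis
    using xf by (simp add: aug_C_def pad_append[OF C0])
qed

subsection \<open>Error dynamics\<close>

lemma sub_LC_mult_vec:
  assumes L: "L \<in> carrier_mat (n + p) p" and e: "e \<in> carrier_vec (n + p)"
  shows "(A - L * C) *\<^sub>v e = A *\<^sub>v e - L *\<^sub>v (C *\<^sub>v e)"
  using e by (simp add: minus_mult_distrib_mat_vec[OF A_carrier mult_carrier_mat[OF L C_carrier]]
      assoc_mult_mat_vec[OF L C_carrier])

text \<open>Cancelling the inverse turns the conjugation into \<open>D * T = T * M\<close>, with M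
  the closed-loop matrix and D the block diagonal one; this is then read off row by row.\<close>

lemma gain_coord:
  assumes L: "L \<in> carrier_mat (n + p) p"
    and F: "\<And>i. i < p \<Longrightarrow> F i \<in> carrier_mat (r i + 1) (r i + 1)"
    and dec: "T * (A - L * C) * the (mat_inverse T) = diag_block_mat (map F [0..<p])"
    and i: "i < p" "s \<le> r i" and e: "e \<in> carrier_vec (n + p)"
  shows "coord i s ((A - L * C) *\<^sub>v e) = (\<Sum>t\<le>r i. F i $$ (s, t) * coord i t e)"
proof -
  let ?M = "A - L * C" and ?D = "diag_block_mat (map F [0..<p])"
  obtain Ti where Ti: "mat_inverse T = Some Ti" "Ti \<in> carrier_mat (n + p) (n + p)" "Ti * T = 1\<^sub>m (n + p)"
    by (rule T_inverse)
  have M: "?M \<in> carrier_mat (n + p) (n + p)"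
    by (rule minus_carrier_mat[OF mult_carrier_mat[OF L C_carrier]])
  have TM: "T * ?M \<in> carrier_mat (n + p) (n + p)"
    by (rule mult_carrier_mat[OF T_carrier M])
  have D: "?D \<in> carrier_mat (n + p) (n + p)"
    using mult_carrier_mat[OF TM Ti(2)] dec Ti(1) by simp
  have "?D * T = T * ?M * (Ti * T)"
    using dec Ti(1) assoc_mult_mat[OF TM Ti(2) T_carrier] by simp
  then have DT: "?D * T = T * ?M"
    unfolding Ti(3) by (simp only: right_mult_one_mat[OF TM])
  have Te: "T *\<^sub>v e \<in> carrier_vec (n + p)" and Me: "?M *\<^sub>v e \<in> carrier_vec (n + p)"
    using e mult_mat_vec_carrier[OF T_carrier] mult_mat_vec_carrier[OF M] by auto
  obtain v where v: "v < n + p" "bi ! v = (i, s)" by (rule bi_index[OF i])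
  let ?g = "\<lambda>(j, t). if j = i then F i $$ (s, t) * coord i t e else 0"
  have "coord i s (?M *\<^sub>v e) = (T *\<^sub>v (?M *\<^sub>v e)) $ v"
    by (rule T_index[OF v Me, symmetric])
  also have "T *\<^sub>v (?M *\<^sub>v e) = ?D *\<^sub>v (T *\<^sub>v e)"
    using assoc_mult_mat_vec[OF T_carrier M e] assoc_mult_mat_vec[OF D T_carrier e] DT by simp
  also have "\<dots> $ v = (\<Sum>w<n + p. ?D $$ (v, w) * (T *\<^sub>v e) $ w)"
    by (rule mult_mat_vec_index_sum[OF D Te v(1)])
  also have "\<dots> = (\<Sum>w<length bi. ?g (bi ! w))"
  proof (rule sum.cong)
    fix w assume "w \<in> {..<length bi}"
    then have w: "w < n + p" by simp
    then obtain j t where jt: "bi ! w = (j, t)" by (cases "bi ! w")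
    show "?D $$ (v, w) * (T *\<^sub>v e) $ w = ?g (bi ! w)"
      unfolding T_index[OF w jt e] jt using diag_block_mat_index[OF F, where v = v and w = w] v w jt by simp
  qed simp
  also have "\<dots> = (\<Sum>j<p. \<Sum>t\<le>r j. ?g (j, t))"
    by (rule sum_block_index)
  also have "\<dots> = (\<Sum>j<p. if j = i then \<Sum>t\<le>r i. F i $$ (s, t) * coord i t e else 0)"
    by (rule sum.cong) auto
  also have "\<dots> = (\<Sum>t\<le>r i. F i $$ (s, t) * coord i t e)"
    using i(1) by simp
  finally show ?thesis .
qed

text \<open>
  Evaluating the closed loop at the preimage under \<open>T\<close> of a unit vector that is not the first one
  of its block: such a state is invisible to \<open>C\<close>, so the injection \<open>L\<close> does not contribute.
\<close>

lemma block_superdiagonal: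
  assumes L: "L \<in> carrier_mat (n + p) p"
    and F: "\<And>i. i < p \<Longrightarrow> F i \<in> carrier_mat (r i + 1) (r i + 1)"
    and dec: "T * (A - L * C) * the (mat_inverse T) = diag_block_mat (map F [0..<p])"
    and i: "i < p" "s \<le> r i" "Suc t \<le> r i"
  shows "F i $$ (s, Suc t) = (if s = t then 1 else 0)"
proof -
  obtain Ti where Ti: "Ti \<in> carrier_mat (n + p) (n + p)" "T * Ti = 1\<^sub>m (n + p)"
    using T_inverse by metis
  obtain w where w: "w < n + p" "bi ! w = (i, Suc t)" by (rule bi_index[OF i(1,3)])
  define e where "e = Ti *\<^sub>v unit_vec (n + p) w"
  have e: "e \<in> carrier_vec (n + p)"
    unfolding e_def by (rule mult_mat_vec_carrier[OF Ti(1)]) simp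
  have Te: "T *\<^sub>v e = unit_vec (n + p) w"
    unfolding e_def using assoc_mult_mat_vec[OF T_carrier Ti(1), symmetric] Ti(2) by simp
  have coord_e: "coord j q e = (if j = i \<and> q = Suc t then 1 else 0)" if jq: "j < p" "q \<le> r j" for j q
  proof -
    obtain v where v: "v < n + p" "bi ! v = (j, q)" by (rule bi_index[OF jq])
    then have "v = w \<longleftrightarrow> j = i \<and> q = Suc t"
      using w bi_inj[OF v(1) w(1)] by auto
    then show ?thesis
      using T_index[OF v e] v(1) w(1) by (simp add: Te)
  qed
  have out_e: "out j 0 e = 0" if "j < p" for j
    using coord_e[OF that, of 0] by (simp add: coord_def)
  have "L *\<^sub>v 0\<^sub>v p = 0\<^sub>v (n + p)"
    using L by (intro eq_vecI) auto
  then have "(A - L * C) *\<^sub>v e = A *\<^sub>v e"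
    using mult_mat_vec_carrier[OF A_carrier e]
    by (simp add: sub_LC_mult_vec[OF L e] C_null[OF e out_e])
  then have "(\<Sum>q\<le>r i. F i $$ (s, q) * coord i q e) = coord i s (A *\<^sub>v e)"
    using gain_coord[OF L F dec i(1,2) e] by simp
  also have "\<dots> = coord i (Suc s) e"
    using coord_A[OF i(1,2) e] out_e by simp
  also have "\<dots> = (if s = t then 1 else 0)"
  proof (cases "s < r i")
    case True
    then show ?thesis using coord_e[OF i(1), of "Suc s"] by simp
  next
    \<comment> \<open>At the end of the block, the next coordinate is the extension to
      \<open>r i + 1\<close>, which is 0 on every state; this agrees with
      \<open>s \<noteq> t\<close>, since \<open>t < r i\<close>.\<close>
    case False
    then have "s = r i" using i(2) by simp
    moreover have "coord i (Suc (r i)) e = 0"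
      using coord_end[OF i(1) vec_first_carrier vec_last_carrier, of e e] vec_first_last_append[OF e] by simp
    ultimately show ?thesis using i(3) by auto
  qed
  also have "(\<Sum>q\<le>r i. F i $$ (s, q) * coord i q e) = (\<Sum>q\<le>r i. if q = Suc t then F i $$ (s, Suc t) else 0)"
    by (rule sum.cong) (auto simp: coord_e[OF i(1)])
  finally show ?thesis using i(3) by simp
qed

text \<open>The known input cancels in the error, leaving the variation of f as the only excitation
  of a system at rest. The block sum yields \<open>gain i\<close> times the claimed identity, and
  \<open>gain i\<close> is nonzero.\<close>

lemma dist_error_response:
  assumes B0: "B0 \<in> carrier_mat n m"
    and plant: "plant_trajectory n m p A0 B0 E0 C0 u f x y"
    and eso: "eso_gain n p r A0 E0 C0 a b \<omega> L"
    and obs: "eso_trajectory n m p A0 B0 E0 C0 L u y xh"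
    and init: "xh 0 = x 0 @\<^sub>v f 0"
    and i: "i < p"
  shows "dist_error p f xh k $ i = conv (impulse_resp (r i) (\<omega> i)) (\<lambda>l. variation f l $ i) k"
proof -
  obtain F where L: "L \<in> carrier_mat (n + p) p"
    and F: "\<And>i. i < p \<Longrightarrow> F i \<in> carrier_mat (r i + 1) (r i + 1)"
    and cp: "\<And>i. i < p \<Longrightarrow> char_poly (F i) = [:- \<omega> i, 1:] ^ (r i + 1)"
    and dec: "T * (A - L * C) * the (mat_inverse T) = diag_block_mat (map F [0..<p])"
    using eso unfolding eso_gain_def by blast
  have tr: "u k \<in> carrier_vec m" "f k \<in> carrier_vec p" "x k \<in> carrier_vec n"
    "x (Suc k) = A0 *\<^sub>v x k + B0 *\<^sub>v u k + E0 *\<^sub>v f k" "y k = C0 *\<^sub>v x k" for k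
    using plant unfolding plant_trajectory_def by blast+
  have ob: "xh k \<in> carrier_vec (n + p)"
    "xh (Suc k) = A *\<^sub>v xh k + aug_B m p B0 *\<^sub>v u k + L *\<^sub>v (y k - C *\<^sub>v xh k)" for k
    using obs unfolding eso_trajectory_def by blast+
  define e where "e k = (x k @\<^sub>v f k) - xh k" for k
  have xf: "x k @\<^sub>v f k \<in> carrier_vec (n + p)" for k using tr(2,3) by simp
  have e: "e k \<in> carrier_vec (n + p)" for k
    using ob(1) xf by (simp add: e_def)
  have var: "variation f k \<in> carrier_vec p" for k
    using tr(2) by (simp add: variation_def)
  have e_Suc: "e (Suc k) = (A - L * C) *\<^sub>v e k + (0\<^sub>v n @\<^sub>v variation f k)" for k
  proof -
    have "0\<^sub>m p m *\<^sub>v u k = 0\<^sub>v p"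
      using tr(1)[of k] by (intro eq_vecI) auto
    then have Bu: "aug_B m p B0 *\<^sub>v u k = (B0 *\<^sub>v u k) @\<^sub>v 0\<^sub>v p"
      unfolding aug_B_def using mat_mult_append[OF B0 zero_carrier_mat tr(1)[of k], of p] tr(1)[of k]
      by simp
    have car: "A0 *\<^sub>v x k \<in> carrier_vec n" "B0 *\<^sub>v u k \<in> carrier_vec n" "E0 *\<^sub>v f k \<in> carrier_vec n"
      using mult_mat_vec_carrier[OF A0] mult_mat_vec_carrier[OF B0] mult_mat_vec_carrier[OF E0] tr by blast+
    have "(X + U + V) @\<^sub>v h' = ((X + V) @\<^sub>v h) + (U @\<^sub>v 0\<^sub>v p) + (0\<^sub>v n @\<^sub>v (h' - h))"
      if "X \<in> carrier_vec n" "U \<in> carrier_vec n" "V \<in> carrier_vec n"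
        "h \<in> carrier_vec p" "h' \<in> carrier_vec p" for X U V h h' :: "real vec"
      using that by (intro eq_vecI) auto
    from this[OF car tr(2)[of k] tr(2)[of "Suc k"]]
    have plant': "x (Suc k) @\<^sub>v f (Suc k) =
        A *\<^sub>v (x k @\<^sub>v f k) + aug_B m p B0 *\<^sub>v u k + (0\<^sub>v n @\<^sub>v variation f k)"
      using tr by (simp add: A_append Bu variation_def)
    have yC: "y k = C *\<^sub>v (x k @\<^sub>v f k)"
      using tr by (simp add: aug_C_def pad_append[OF C0])
    have Ae: "A *\<^sub>v e k = A *\<^sub>v (x k @\<^sub>v f k) - A *\<^sub>v xh k"
      unfolding e_def by (rule mult_minus_distrib_mat_vec[OF A_carrier xf ob(1)])
    have Ce: "C *\<^sub>v e k = y k - C *\<^sub>v xh k"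
      unfolding e_def yC by (rule mult_minus_distrib_mat_vec[OF C_carrier xf ob(1)])
    have M: "(A - L * C) *\<^sub>v e k = A *\<^sub>v (x k @\<^sub>v f k) - A *\<^sub>v xh k - L *\<^sub>v (y k - C *\<^sub>v xh k)"
      by (simp only: sub_LC_mult_vec[OF L e] Ae Ce)
    have c: "A *\<^sub>v (x k @\<^sub>v f k) \<in> carrier_vec (n + p)" "A *\<^sub>v xh k \<in> carrier_vec (n + p)"
      "aug_B m p B0 *\<^sub>v u k \<in> carrier_vec (n + p)" "L *\<^sub>v (y k - C *\<^sub>v xh k) \<in> carrier_vec (n + p)"
      "0\<^sub>v n @\<^sub>v variation f k \<in> carrier_vec (n + p)"
      using mult_mat_vec_carrier[OF A_carrier xf] mult_mat_vec_carrier[OF A_carrier ob(1)] car(2) var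
        mult_mat_vec_carrier[OF L, of "y k - C *\<^sub>v xh k"] mult_mat_vec_carrier[OF C_carrier ob(1)]
        mult_mat_vec_carrier[OF C_carrier xf] by (auto simp: Bu yC)
    have "X + U + V - (Y + U + W) = X - Y - W + V"
      if "X \<in> carrier_vec (n + p)" "Y \<in> carrier_vec (n + p)" "U \<in> carrier_vec (n + p)"
        "W \<in> carrier_vec (n + p)" "V \<in> carrier_vec (n + p)" for X Y U V W :: "real vec"
      using that by (intro eq_vecI) auto
    from this[OF c] show ?thesis
      unfolding e_def[of "Suc k"] M plant' ob(2) .
  qed
  define z where "z s k = coord i s (e k)" for s k
  define \<nu> where "\<nu> k = gain i * variation f k $ i" for k
  have z_Suc: "z s (Suc k) = (\<Sum>t\<le>r i. F i $$ (s, t) * z t k) + (if s = r i then \<nu> k else 0)"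
    if "s \<le> r i" for s k
  proof -
    have Me: "(A - L * C) *\<^sub>v e k \<in> carrier_vec (n + p)"
      by (rule mult_mat_vec_carrier[OF minus_carrier_mat[OF mult_carrier_mat[OF L C_carrier]] e])
    have h: "0\<^sub>v n @\<^sub>v variation f k \<in> carrier_vec (n + p)" using var by simp
    show ?thesis
      using gain_coord[OF L F dec i that e[of k]] coord_add[OF Me h i, of s] coord_dist[OF i that var[of k]]
      by (simp only: z_def e_Suc \<nu>_def)
  qed
  define g where "g s = F i $$ (s, 0)" for s
  have F_sum: "(\<Sum>t\<le>r i. F i $$ (s, t) * z t k) = g s * z 0 k + (if s < r i then z (Suc s) k else 0)"
    if "s \<le> r i" for s k
  proof -
    have "(\<Sum>t\<le>r i. F i $$ (s, t) * z t k) = g s * z 0 k + (\<Sum>t<r i. F i $$ (s, Suc t) * z (Suc t) k)"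
      unfolding g_def by (simp add: lessThan_Suc_atMost[symmetric] sum.lessThan_Suc_shift del: sum.lessThan_Suc)
    also have "(\<Sum>t<r i. F i $$ (s, Suc t) * z (Suc t) k) = (\<Sum>t<r i. if t = s then z (Suc s) k else 0)"
      using block_superdiagonal[OF L F dec i that] by (intro sum.cong) auto
    finally show ?thesis by simp
  qed
  have sum_z: "(\<Sum>s\<le>r i. z s k) = (\<Sum>l<k. binom_cdf (r i) (\<omega> i) (k - Suc l) * \<nu> l)"
  proof (rule observer_chain_response)
    show "z s (Suc k) = z (Suc s) k + g s * z 0 k" if "s < r i" for s k
      using z_Suc[of s k] F_sum[of s k] that by simp
    show "z (r i) (Suc k) = g (r i) * z 0 k + \<nu> k" for k
      using z_Suc[of "r i" k] F_sum[of "r i" k] by simp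
    show "z s 0 = 0" if "s \<le> r i" for s
    proof -
      have "e 0 = 0\<^sub>v (n + p)"
        using xf[of 0] by (simp add: e_def init)
      also have "0\<^sub>v (n + p) = 0\<^sub>v n @\<^sub>v (0\<^sub>v p :: real vec)"
        by (intro eq_vecI) auto
      finally show ?thesis
        using i by (simp add: z_def coord_dist[OF i that])
    qed
    have "char_poly (F i) = comp_poly g (r i + 1)"
      using F[OF i] by (intro char_poly_companion) (auto simp: g_def block_superdiagonal[OF L F dec i])
    then show "comp_poly g (Suc (r i)) = [:- \<omega> i, 1:] ^ Suc (r i)"
      using cp[OF i] by simp
  qed
  have "vec_last (e k) p $ i = dist_error p f xh k $ i"
    using i ob(1)[of k] tr(2,3)[of k] by (simp add: vec_last_def dist_error_def e_def)
  then have "(\<Sum>s\<le>r i. z s k) = gain i * dist_error p f xh k $ i"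
    using sum_coord[OF i vec_first_carrier vec_last_carrier, of "e k" "e k"] vec_first_last_append[OF e]
    by (simp add: z_def)
  then have "gain i * dist_error p f xh k $ i =
      gain i * (\<Sum>l<k. binom_cdf (r i) (\<omega> i) (k - Suc l) * variation f l $ i)"
    unfolding sum_z by (simp add: \<nu>_def sum_distrib_left mult_ac)
  then show ?thesis
    using gain_nonzero[OF i] by (simp add: conv_impulse_resp)
qed

end

theorem theorem3:
  fixes n m p :: nat and r :: "nat \<Rightarrow> nat"
    and A0 B0 E0 C0 :: "real mat"
    and a b :: "nat \<Rightarrow> nat \<Rightarrow> nat \<Rightarrow> real"
    and u f x y :: "nat \<Rightarrow> real vec"
    and \<omega> :: "nat \<Rightarrow> real" and L :: "real mat" and xh :: "nat \<Rightarrow> real vec"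
  assumes "A0 \<in> carrier_mat n n" and "B0 \<in> carrier_mat n m"
    and "E0 \<in> carrier_mat n p" and "C0 \<in> carrier_mat p n"
    and "vec_space.rank p C0 = p"
    and "\<forall>i<p. 0 < r i"
    and "relative_degree_condition n p r A0 E0 C0"
    and "canonical_coeffs n p r A0 C0 a b"
    and "diagonal_mat (gain_mat p r A0 E0 C0)"
    and "plant_trajectory n m p A0 B0 E0 C0 u f x y"
    and "\<forall>i<p. \<bar>\<omega> i\<bar> < 1"
    and "eso_gain n p r A0 E0 C0 a b \<omega> L"
    and "eso_trajectory n m p A0 B0 E0 C0 L u y xh"
    and "xh 0 = x 0 @\<^sub>v f 0"
  shows "(\<forall>k. dist_error p f xh k =
             vec p (\<lambda>i. conv (impulse_resp (r i) (\<omega> i)) (\<lambda>l. variation f l $ i) k))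
       \<and> (\<forall>i<p. \<forall>k0. single_change f i k0 \<longrightarrow>
             (\<forall>Lw xhw.
                (\<forall>w \<in> {0<..<1}.
                   eso_gain n p r A0 E0 C0 a b (\<omega>(i := w)) (Lw w) \<and>
                   eso_trajectory n m p A0 B0 E0 C0 (Lw w) u y (xhw w) \<and>
                   xhw w 0 = x 0 @\<^sub>v f 0) \<longrightarrow>
                (\<forall>k \<ge> k0 + r i + 2.
                   strict_mono_on {0<..<1} (\<lambda>w. \<bar>dist_error p f (xhw w) k $ i\<bar>) \<and>
                   ((\<lambda>w. \<bar>dist_error p f (xhw w) k $ i\<bar>) \<longlongrightarrow> 0) (at_right 0))))
       \<and> (\<forall>i<p. \<forall>k0. single_change f i k0 \<longrightarrow> 0 < \<omega> i \<longrightarrow> \<omega> i < 1 \<longrightarrow>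
             strict_antimono_on {k0 + r i + 1..} (\<lambda>k. \<bar>dist_error p f xh k $ i\<bar>) \<and>
             (\<lambda>k. \<bar>dist_error p f xh k $ i\<bar>) \<longlonglongrightarrow> 0)"
proof (intro conjI allI impI)
  interpret decoupled_plant n p r A0 E0 C0 a b
    using assms by unfold_locales auto
  note err = dist_error_response[OF assms(2,10)]
  \<comment> \<open>Stated for arbitrary poles and gain, so that it serves both the given observer
    and the family in which only \<open>\<omega> i\<close> varies.\<close>
  have single: "dist_error p f X (Suc (k0 + N)) $ i = binom_cdf (r i) (\<Omega> i) N * variation f k0 $ i"
    if "eso_gain n p r A0 E0 C0 a b \<Omega> M" "eso_trajectory n m p A0 B0 E0 C0 M u y X"
      "X 0 = x 0 @\<^sub>v f 0" "i < p" "single_change f i k0" for \<Omega> M X i k0 N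
    using that(5) unfolding err[OF that(1-4)] single_change_def
    by (intro conv_impulse_resp_single) auto
  show "dist_error p f xh k =
      vec p (\<lambda>i. conv (impulse_resp (r i) (\<omega> i)) (\<lambda>l. variation f l $ i) k)" for k
    using err[OF assms(12-14)] by (intro eq_vecI) (auto simp: dist_error_def)
  {
    fix i k0 Lw xhw k
    assume i: "i < p" and ch: "single_change f i k0" and k: "k0 + r i + 2 \<le> k"
      and w: "\<forall>w \<in> {0<..<1}.
         eso_gain n p r A0 E0 C0 a b (\<omega>(i := w)) (Lw w) \<and>
         eso_trajectory n m p A0 B0 E0 C0 (Lw w) u y (xhw w) \<and> xhw w 0 = x 0 @\<^sub>v f 0"
    \<comment> \<open>The number of binomial trials: the change occurs at \<open>k0\<close> and the
      response is delayed by one step. The bound on \<open>k\<close> means \<open>r i < N\<close>,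
      exactly where the distribution function is no longer constant in \<open>w\<close>.\<close>
    define N where "N = k - Suc k0"
    have N: "r i < N" "k = Suc (k0 + N)" using k by (auto simp: N_def)
    let ?v = "\<bar>variation f k0 $ i\<bar>"
    have v: "0 < ?v" using ch by (simp add: single_change_def)
    have eq: "\<bar>dist_error p f (xhw w) k $ i\<bar> = binom_cdf (r i) w N * ?v" if "w \<in> {0<..<1}" for w
      using single[of "\<omega>(i := w)" "Lw w" "xhw w" i k0 N] w that i ch binom_cdf_pos[of w "r i" N]
      by (simp add: N(2) abs_mult)
    show "strict_mono_on {0<..<1} (\<lambda>w. \<bar>dist_error p f (xhw w) k $ i\<bar>)"
      using strict_mono_onD[OF binom_cdf_strict_mono[OF N(1)]] v
      by (intro strict_mono_onI) (simp add: eq)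
    have "((\<lambda>w. binom_cdf (r i) w N * ?v) \<longlongrightarrow> 0) (at_right 0)"
      using tendsto_mult_left_zero[OF binom_cdf_at_0[OF N(1)]] .
    \<comment> \<open>The observers are given only for poles in the open unit interval, so the two
      functions agree only near 0 from the right.\<close>
    moreover have "\<forall>\<^sub>F w in at_right 0. binom_cdf (r i) w N * ?v = \<bar>dist_error p f (xhw w) k $ i\<bar>"
      using eventually_at_right_real[of 0 1] by (auto elim!: eventually_mono simp: eq)
    ultimately show "((\<lambda>w. \<bar>dist_error p f (xhw w) k $ i\<bar>) \<longlongrightarrow> 0) (at_right 0)"
      by (rule Lim_transform_eventually)
  next
    fix i k0
    assume i: "i < p" and ch: "single_change f i k0" and \<omega>: "0 < \<omega> i" "\<omega> i < 1"
    let ?v = "\<bar>variation f k0 $ i\<bar>"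
    have v: "0 < ?v" using ch by (simp add: single_change_def)
    have eq: "\<bar>dist_error p f xh (Suc (k0 + N)) $ i\<bar> = binom_cdf (r i) (\<omega> i) N * ?v" for N
      using single[OF assms(12-14) i ch] binom_cdf_pos[OF \<omega>, of "r i" N] by (simp add: abs_mult)
    show "strict_antimono_on {k0 + r i + 1..} (\<lambda>k. \<bar>dist_error p f xh k $ i\<bar>)"
    proof (rule monotone_onI)
      fix k k' assume k: "k \<in> {k0 + r i + 1..}" and "k < k'"
      have dec: "\<bar>dist_error p f xh (Suc l) $ i\<bar> < \<bar>dist_error p f xh l $ i\<bar>" if "k \<le> l" for l
      proof -
        define N where "N = l - Suc k0"
        have N: "r i \<le> N" "l = Suc (k0 + N)" using k that by (auto simp: N_def)
        \<comment> \<open>Here \<open>N = r i\<close> is allowed: the weight lost in the step to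
          \<open>N + 1\<close> is already positive.\<close>
        have "binom_cdf (r i) (\<omega> i) (Suc N) < binom_cdf (r i) (\<omega> i) N"
          unfolding binom_cdf_Suc using binom_weight_pos[OF \<omega>(1) N(1)] \<omega>(2) by (simp del: power_Suc)
        then show ?thesis
          using eq[of N] eq[of "Suc N"] v by (simp add: N(2))
      qed
      show "\<bar>dist_error p f xh k' $ i\<bar> < \<bar>dist_error p f xh k $ i\<bar>"
        using \<open>k < k'\<close>
      proof (induction k')
        case (Suc l)
        then show ?case using dec[of l] by (cases "k = l") auto
      qed simp
    qed
    have "(\<lambda>N. \<bar>dist_error p f xh (Suc (k0 + N)) $ i\<bar>) \<longlonglongrightarrow> 0"
      unfolding eq using tendsto_mult_left_zero[OF binom_cdf_tendsto_0[OF \<omega>]] .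
    then show "(\<lambda>k. \<bar>dist_error p f xh k $ i\<bar>) \<longlonglongrightarrow> 0"
      using LIMSEQ_offset[of "\<lambda>k. \<bar>dist_error p f xh k $ i\<bar>" "Suc k0"] by (simp add: add.commute)
  }
qed

end
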